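(* There exist absolute constants $\varepsilon > 0$ and $c > 0$ such that the following holds. If $q = q(n) = 1 - p(n)$ is a smooth function with $n^{-1}\log n \ll q \ll n^{-2/3}$, then for infinitely many values of $n \in \mathbb{N}$ we have $$\mathbb{P}\Big( \chi\big( G(n,p) \big) \in I_n \Big) \le 1 - \varepsilon$$ for every interval $I_n$ of length $|I_n| \le c\, n^{3/2} q^{3/2}$.
   Context: $G(n,p)$ is the binomial random graph on $n$ labelled vertices with edge probability $p = p(n)$; $\chi$ denotes the chromatic number. For functions of $n$, $f \ll g$ means $f(n)/g(n) \to 0$ as $n \to \infty$. A function $q \colon \mathbb{N} \to [0,1]$ is called \emph{smooth} if $$q(n+1) = q(n) + o\left( \frac{1}{q(n)^2 n^3} \right)$$ as $n \to \infty$. *)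

theory Defs
  imports "HOL-Probability.Probability" "HOL-Library.Ramsey" "HOL-Library.Landau_Symbols"
begin

text \<open>A finite simple graph is given by a vertex set \<open>V\<close> and a set \<open>E\<close> of
  two-element subsets of \<open>V\<close>.\<close>

definition proper_colouring :: "'a set \<Rightarrow> 'a set set \<Rightarrow> nat \<Rightarrow> ('a \<Rightarrow> nat) \<Rightarrow> bool" where
  "proper_colouring V E k f \<longleftrightarrow>
     (\<forall>v\<in>V. f v < k) \<and> (\<forall>u\<in>V. \<forall>v\<in>V. {u, v} \<in> E \<longrightarrow> f u \<noteq> f v)"

definition chromatic_number :: "'a set \<Rightarrow> 'a set set \<Rightarrow> nat" where
  "chromatic_number V E = (LEAST k. \<exists>f. proper_colouring V E k f)"

text \<open>The edge set of \<open>G(n,p)\<close> on the vertex set \<open>{..<n}\<close>: every pair is included independently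
  with probability \<open>p\<close>. The value \<open>False\<close> is only the default that \<open>Pi_pmf\<close> requires outside its
  index set. Note that \<open>bernoulli_pmf\<close> truncates its parameter to \<open>[0,1]\<close>.\<close>

definition gnp :: "nat \<Rightarrow> real \<Rightarrow> nat set set pmf" where
  "gnp n p = map_pmf (\<lambda>X. {e \<in> nsets {..<n} 2. X e})
     (Pi_pmf (nsets {..<n} 2) False (\<lambda>_. bernoulli_pmf p))"

text \<open>Where \<open>q n = 0\<close> the error bound below is \<open>1 / 0 = 0\<close> by convention; this can only matter for
  functions that vanish infinitely often, never for those with \<open>ln n / n = o(q n)\<close>.\<close>

definition smooth :: "(nat \<Rightarrow> real) \<Rightarrow> bool" where
  "smooth q \<longleftrightarrow> (\<forall>n. 0 \<le> q n \<and> q n \<le> 1) \<and>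
     (\<lambda>n. q (Suc n) - q n) \<in> o(\<lambda>n. 1 / ((q n)\<^sup>2 * real n ^ 3))"

end

theory Submission
  imports Defs
begin

text \<open>
  Write \<open>H\<close> for the complement of the random graph, so that the edges of \<open>H\<close> are independent with
  probability \<open>q\<close>, put \<open>d = n q\<close>, and let \<open>\<nu>\<close> be the largest number of pairwise vertex-disjoint
  triangles in \<open>H\<close>. A proper colouring is a partition of the vertices into cliques of \<open>H\<close>. In the range
  \<open>ln n / n \<lless> q \<lless> n powr (-2/3)\<close> the number \<open>\<nu>\<close> determines the chromatic number up to rounding, and
  \<open>\<nu>\<close> is spread over an interval of length of order \<open>d powr (3/2)\<close>. This proves the claim for every
  large \<open>n\<close>.

  First, the chromatic number \<open>\<chi>\<close> is \<open>(n - \<nu>) / 2\<close> up to rounding. Because \<open>n^4 q^6\<close> is small,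
  \<open>H\<close> typically has no clique on four vertices; colour classes then have at most three vertices, the classes of size three form
  a triangle packing, and \<open>n \<le> 2 \<chi> + \<nu>\<close>. Conversely \<open>2 \<chi> + \<nu> \<le> n + 1\<close> holds as soon as the vertices
  outside a maximum packing have a matching that misses at most one of them. Such a matching comes from
  the deterministic \<open>expanding_graph_near_perfect_matching\<close>: small sets expand, and large disjoint sets
  are joined by an edge. Both properties survive the removal of the packing
  (\<open>pseudorandom_near_perfect_matching\<close>): since \<open>d\<close> is much larger than \<open>ln n\<close>, all degrees are of order
  \<open>d\<close> or larger, and no remaining vertex loses more than a small fraction of \<open>d\<close> neighbours.

  Second, the packing number is not concentrated. Add the three edges of a uniformly random triple to \<open>H\<close>.
  With probability near one the triple is disjoint from a maximum packing, so \<open>\<nu>\<close> grows by one.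
  On the other hand the law of \<open>H\<close> hardly changes: the enlarged graph has density \<open>L = T / E T\<close> with respect to \<open>H\<close>, where
  \<open>T\<close> counts triangles, and the variance of \<open>L\<close> is of order \<open>1 / d ^ 3\<close>. If \<open>h\<close> truncates \<open>\<nu>\<close> to a window of
  length \<open>l\<close>, the expectation of \<open>h\<close> rises by about the probability that \<open>\<nu>\<close> lies in the window, and
  yet by at most \<open>l / 2\<close> times the standard deviation of \<open>L\<close>. For \<open>l\<close> a small multiple of
  \<open>d powr (3/2)\<close> that probability is therefore bounded away from one
  (\<open>planting_anticoncentration\<close>).
\<close>

section \<open>Maximum matchings and rotations\<close>

definition matching_in :: "'a set set \<Rightarrow> 'a set set \<Rightarrow> bool" where
  "matching_in G M \<longleftrightarrow> M \<subseteq> G \<and> disjoint M"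

definition maximum_matching :: "'a set set \<Rightarrow> 'a set set \<Rightarrow> bool" where
  "maximum_matching G M \<longleftrightarrow> matching_in G M \<and> (\<forall>M'. matching_in G M' \<longrightarrow> card M' \<le> card M)"

lemma matching_in_insert:
  assumes "matching_in G M" "e \<in> G" "e \<inter> \<Union>M = {}"
  shows "matching_in G (insert e M)"
  using assms unfolding matching_in_def by (auto simp: pairwise_insert disjnt_def)

lemma matching_in_subset: "matching_in G M \<Longrightarrow> M' \<subseteq> M \<Longrightarrow> matching_in G M'"
  unfolding matching_in_def by (meson pairwise_subset subset_trans)

lemma matching_in_same_edge:
  assumes "matching_in G M" "e \<in> M" "e' \<in> M" "x \<in> e" "x \<in> e'"
  shows "e = e'"
  using assms unfolding matching_in_def pairwise_def disjnt_def by blast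

lemma maximum_matching_no_extension:
  assumes "finite G" "maximum_matching G M" "e \<in> G" "e \<noteq> {}"
  shows "e \<inter> \<Union>M \<noteq> {}"
proof
  assume e: "e \<inter> \<Union>M = {}"
  have "matching_in G (insert e M)"
    using assms e matching_in_insert unfolding maximum_matching_def by blast
  moreover have "finite M"
    using assms finite_subset unfolding maximum_matching_def matching_in_def by blast
  moreover have "e \<notin> M" using e assms(4) by blast
  ultimately show False using assms(2) unfolding maximum_matching_def by fastforce
qed

text \<open>
  The pairs of a matching and an exposed vertex reachable from a matching that misses \<open>u\<close>: if the
  current matching misses \<open>x\<close>, is joined to \<open>y\<close> and \<open>y\<close> is matched to \<open>z\<close>, then swapping \<open>{y, z}\<close> for
  \<open>{x, y}\<close> exposes \<open>z\<close> instead of \<open>x\<close>.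
\<close>

inductive rotations :: "'a set set \<Rightarrow> 'a set set \<Rightarrow> 'a \<Rightarrow> 'a set set \<Rightarrow> 'a \<Rightarrow> bool"
  for G M0 u where
  start: "rotations G M0 u M0 u"
| rotate: "rotations G M0 u M x \<Longrightarrow> {x, y} \<in> G \<Longrightarrow> {y, z} \<in> M \<Longrightarrow>
     rotations G M0 u (insert {x, y} (M - {{y, z}})) z"

text \<open>
  A rotation only moves the exposed vertex. A second missed vertex \<open>v\<close> is never absorbed, because an
  edge at \<open>v\<close> would have to replace a matching edge at \<open>v\<close>.
\<close>

lemma rotations_maximum:
  assumes fin: "finite G" and two: "\<And>e. e \<in> G \<Longrightarrow> card e = 2"
    and max: "maximum_matching G M0" and uv: "u \<notin> \<Union>M0" "v \<notin> \<Union>M0" "u \<noteq> v"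
    and rot: "rotations G M0 u M x"
  shows "maximum_matching G M \<and> x \<notin> \<Union>M \<and> v \<notin> \<Union>M \<and> x \<noteq> v"
  using rot
proof (induction rule: rotations.induct)
  case start
  then show ?case using max uv by auto
next
  case (rotate M x y z)
  let ?N = "insert {x, y} (M - {{y, z}})"
  have M: "matching_in G M" using rotate.IH unfolding maximum_matching_def by blast
  have MG: "M \<subseteq> G" using M unfolding matching_in_def by blast
  have finM: "finite M" using MG fin finite_subset by blast
  have yz: "y \<noteq> z" using two[of "{y, z}"] rotate.hyps(3) MG by (auto simp: card_insert_if)
  have xy: "x \<noteq> y" using rotate by blast
  have out: "w \<notin> \<Union>(M - {{y, z}})" if "w \<in> {y, z}" for w
    using matching_in_same_edge[OF M rotate.hyps(3)] that by fastforce
  have mat: "matching_in G ?N"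
    by (rule matching_in_insert[OF matching_in_subset[OF M]])
       (use rotate out in \<open>auto\<close>)
  have "{x, y} \<notin> M - {{y, z}}" using rotate.IH by auto
  then have card: "card ?N = card M"
    using rotate.hyps(3) finM by (metis card_Suc_Diff1 card_insert_disjoint finite_Diff)
  have "maximum_matching G ?N"
    using mat card rotate.IH unfolding maximum_matching_def by simp
  moreover have "z \<notin> \<Union>?N" using out[of z] yz xy rotate by auto
  moreover have "v \<notin> \<Union>?N" "z \<noteq> v" using rotate by auto
  ultimately show ?case by blast
qed

text \<open>
  Posa's argument, in the form for matchings. A neighbour \<open>y\<close> of an endpoint which is not itself an
  endpoint is matched in \<open>M0\<close> to an endpoint: as long as the edge of \<open>M0\<close> at \<open>y\<close> has not been touched, rotating
  over \<open>y\<close> exposes its partner; and when the edge was removed earlier, one of its two ends became an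
  endpoint, and this was not \<open>y\<close>. Hence \<open>M0\<close> injects the outer neighbours into the endpoints other
  than \<open>u\<close>.
\<close>

lemma rotation_endpoints_poorly_expanding:
  assumes fin: "finite G" and two: "\<And>e. e \<in> G \<Longrightarrow> card e = 2"
    and max: "maximum_matching G M0" and uv: "u \<notin> \<Union>M0" "v \<notin> \<Union>M0" "u \<noteq> v"
    and finB: "finite {x. \<exists>M. rotations G M0 u M x}"
  shows "card ({y. \<exists>x\<in>{x. \<exists>M. rotations G M0 u M x}. {x, y} \<in> G} - {x. \<exists>M. rotations G M0 u M x})
           < card {x. \<exists>M. rotations G M0 u M x}"
proof -
  define B where "B = {x. \<exists>M. rotations G M0 u M x}"
  define N where "N = {y. \<exists>x\<in>B. {x, y} \<in> G} - B"
  have rotB: "x \<in> B" if "rotations G M0 u M x" for M x using that unfolding B_def by blast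
  have uB: "u \<in> B" using rotB rotations.start by metis
  have M0: "matching_in G M0" using max unfolding maximum_matching_def by blast
  \<comment> \<open>Rotations cover no vertices beyond those of \<open>M0\<close> except endpoints, and an edge of \<open>M0\<close> at a
     non-endpoint \<open>y\<close> can only disappear by exposing the other end.\<close>
  have inv: "\<Union>M \<subseteq> \<Union>M0 \<union> B \<and> (\<forall>y z. y \<notin> B \<longrightarrow> {y, z} \<in> M0 \<longrightarrow> {y, z} \<in> M \<or> z \<in> B)"
    if "rotations G M0 u M x" for M x using that
  proof (induction rule: rotations.induct)
    case (rotate M x y z)
    have zB: "z \<in> B" using rotations.rotate[OF rotate.hyps] rotB by blast
    have xB: "x \<in> B" using rotate rotB by blast
    have "{y', z'} \<in> insert {x, y} (M - {{y, z}}) \<or> z' \<in> B"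
      if "y' \<notin> B" "{y', z'} \<in> M0" for y' z'
    proof (cases "{y', z'} = {y, z}")
      case True
      then show ?thesis using that zB by (auto simp: doubleton_eq_iff)
    next
      case False
      then show ?thesis using rotate.IH that by blast
    qed
    moreover have "y \<in> \<Union>M" using rotate by blast
    ultimately show ?case using rotate.IH xB by auto
  qed auto
  have partner: "\<exists>z\<in>B - {u}. {y, z} \<in> M0" if yN: "y \<in> N" for y
  proof -
    obtain x M where x: "rotations G M0 u M x" "{x, y} \<in> G" and yB: "y \<notin> B"
      using yN unfolding N_def B_def by blast
    note R = rotations_maximum[OF fin two max uv x(1)]
    have M: "matching_in G M" using R unfolding maximum_matching_def by blast
    have "y \<in> \<Union>M"
      using maximum_matching_no_extension[OF fin _ x(2)] R by blast
    then obtain e where e: "e \<in> M" "y \<in> e" by blast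
    have "card e = 2" using e M two unfolding matching_in_def by blast
    then obtain z where z: "e = {y, z}" using e(2) by (auto simp: card_2_iff)
    have zB: "z \<in> B" using rotations.rotate[OF x] e z rotB by blast
    have "y \<in> \<Union>M0" using inv[OF x(1)] \<open>y \<in> \<Union>M\<close> yB by blast
    then obtain e0 where e0: "e0 \<in> M0" "y \<in> e0" by blast
    have "card e0 = 2" using e0 M0 two unfolding matching_in_def by blast
    then obtain z0 where z0: "e0 = {y, z0}" using e0(2) by (auto simp: card_2_iff)
    have "{y, z0} \<in> M \<or> z0 \<in> B" using inv[OF x(1)] yB e0 z0 by blast
    moreover have "z0 \<in> B" if "{y, z0} \<in> M"
    proof -
      have "{y, z0} = {y, z}" using matching_in_same_edge[OF M that e(1), of y] z by auto
      then show ?thesis using zB by (auto simp: doubleton_eq_iff)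
    qed
    ultimately have "z0 \<in> B" by blast
    moreover have "z0 \<noteq> u" using uv e0 z0 by blast
    ultimately show ?thesis using e0 z0 by blast
  qed
  then obtain f where f: "\<And>y. y \<in> N \<Longrightarrow> f y \<in> B - {u} \<and> {y, f y} \<in> M0" by metis
  have inj: "inj_on f N"
  proof (rule inj_onI)
    fix y y' assume *: "y \<in> N" "y' \<in> N" "f y = f y'"
    then have "{y, f y} = {y', f y'}"
      using f[of y] f[of y'] matching_in_same_edge[OF M0, of "{y, f y}" "{y', f y'}" "f y"] by auto
    then show "y = y'" using * by (auto simp: doubleton_eq_iff)
  qed
  have "finite B" using finB B_def by simp
  then have "card N \<le> card (B - {u})"
    using card_inj_on_le[OF inj] f by blast
  also have "\<dots> < card B" using uB \<open>finite B\<close> by (meson card_Diff1_less)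
  finally show ?thesis unfolding N_def B_def .
qed

text \<open>
  Gallai's lemma: a vertex \<open>w\<close> missed by some maximum matching is missed together with \<open>u\<close> or together
  with \<open>v\<close>, whenever some maximum matching misses both \<open>u\<close> and \<open>v\<close>. The usual proof follows the
  alternating path of \<open>M\<close> and \<open>N\<close> from \<open>w\<close>. The induction peels off its first two vertices \<open>w\<close>, \<open>w1\<close>: the
  rest of \<open>N\<close> misses the third vertex \<open>w2\<close>, and a matching found for \<open>w2\<close> in the smaller graph is
  completed by the edge \<open>{w1, w2}\<close>.
\<close>

lemma matching_missing_prescribed_vertex:
  assumes fin: "finite G" and two: "\<And>e. e \<in> G \<Longrightarrow> card e = 2"
  shows "matching_in G M \<Longrightarrow> matching_in G N \<Longrightarrow> card M = k \<Longrightarrow> card N = k \<Longrightarrow>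
    (\<And>L. matching_in G L \<Longrightarrow> card L \<le> k) \<Longrightarrow>
    u \<notin> \<Union>M \<Longrightarrow> v \<notin> \<Union>M \<Longrightarrow> u \<noteq> v \<Longrightarrow> w \<notin> \<Union>N \<Longrightarrow>
    \<exists>L x. matching_in G L \<and> card L = k \<and> w \<notin> \<Union>L \<and> x \<notin> \<Union>L \<and> x \<in> {u, v} \<and> x \<noteq> w"
  using fin two
proof (induction k arbitrary: G M N w)
  case 0
  then have "M = {}" using finite_subset[of M G] by (auto simp: matching_in_def)
  then show ?case using 0 by (intro exI[of _ "{}"] exI[of _ "if w = u then v else u"]) auto
next
  case (Suc k)
  show ?case
  proof (cases "w \<in> \<Union>M")
    case False
    then show ?thesis using Suc.prems
      by (intro exI[of _ M] exI[of _ "if w = u then v else u"]) auto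
  next
    case True
    have MG: "M \<subseteq> G" and NG: "N \<subseteq> G" using Suc.prems by (auto simp: matching_in_def)
    have finMN: "finite M" "finite N" using Suc.prems MG NG finite_subset by blast+
    obtain e where e: "e \<in> M" "w \<in> e" using True by blast
    have "card e = 2" using e MG Suc.prems by blast
    then obtain w1 where w1: "e = {w, w1}" "w1 \<noteq> w" using e(2) by (auto simp: card_2_iff)
    have maxN: "maximum_matching G N"
      unfolding maximum_matching_def using Suc.prems by auto
    have "w1 \<in> \<Union>N"
      using maximum_matching_no_extension[OF \<open>finite G\<close> maxN, of e] e MG w1 Suc.prems by blast
    then obtain e' where e': "e' \<in> N" "w1 \<in> e'" by blast
    have "card e' = 2" using e' NG Suc.prems by blast
    then obtain w2 where w2: "e' = {w1, w2}" "w2 \<noteq> w1" using e'(2) by (auto simp: card_2_iff)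
    have w2w: "w2 \<noteq> w" using w2 e' Suc.prems by blast
    define G' where "G' = {f \<in> G. f \<inter> {w, w1} = {}}"
    have outM: "f \<inter> {w, w1} = {}" if "f \<in> M - {e}" for f
      using matching_in_same_edge[OF Suc.prems(1) e(1), of f] that w1 by blast
    have outN: "f \<inter> {w, w1, w2} = {}" if "f \<in> N - {e'}" for f
      using matching_in_same_edge[OF Suc.prems(2) e'(1), of f] that w2 Suc.prems by blast
    have lift: "matching_in G (insert h L)" "card (insert h L) = Suc (card L)"
      if "matching_in G' L" "h \<in> G" "h \<inter> \<Union>L = {}" for h L
    proof -
      have LG: "matching_in G L" using that unfolding matching_in_def G'_def by blast
      show "matching_in G (insert h L)" using matching_in_insert[OF LG] that by blast
      have "finite L" using LG Suc.prems finite_subset by (auto simp: matching_in_def)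
      moreover have "h \<noteq> {}" using Suc.prems that(2) by force
      ultimately show "card (insert h L) = Suc (card L)" using that(3)
        by (subst card_insert_disjoint) auto
    qed
    have "\<exists>L x. matching_in G' L \<and> card L = k \<and> w2 \<notin> \<Union>L \<and> x \<notin> \<Union>L \<and> x \<in> {u, v} \<and> x \<noteq> w2"
    proof (rule Suc.IH)
      show "matching_in G' (M - {e})"
        using Suc.prems(1) outM unfolding matching_in_def G'_def
        by (auto intro: pairwise_subset)
      show "matching_in G' (N - {e'})"
        using Suc.prems(2) outN unfolding matching_in_def G'_def
        by (auto intro: pairwise_subset)
      show "card (M - {e}) = k" "card (N - {e'}) = k"
        using Suc.prems e e' finMN by auto
      show "u \<notin> \<Union>(M - {e})" "v \<notin> \<Union>(M - {e})" "u \<noteq> v" "w2 \<notin> \<Union>(N - {e'})"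
        using Suc.prems outN by blast+
      show "finite G'" "\<And>e. e \<in> G' \<Longrightarrow> card e = 2" using Suc.prems unfolding G'_def by auto
      fix L assume L: "matching_in G' L"
      have "e \<inter> \<Union>L = {}" using L w1 unfolding matching_in_def G'_def by blast
      then show "card L \<le> k" using lift[OF L, of e] e MG Suc.prems(5)[of "insert e L"] by auto
    qed
    then obtain L x where L: "matching_in G' L" "card L = k" "w2 \<notin> \<Union>L" "x \<notin> \<Union>L"
      "x \<in> {u, v}" "x \<noteq> w2" by blast
    have "e' \<inter> \<Union>L = {}" using L w2 unfolding matching_in_def G'_def by blast
    then have "matching_in G (insert e' L)" "card (insert e' L) = Suc k"
      using lift[OF L(1), of e'] e' NG L(2) by auto
    moreover have "w \<notin> \<Union>(insert e' L)"
      using L w2 w2w w1 unfolding matching_in_def G'_def by blast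
    moreover have "x \<noteq> w" "x \<noteq> w1" using L(5) Suc.prems e w1 by blast+
    ultimately show ?thesis using L w2
      by (intro exI[of _ "insert e' L"] exI[of _ x]) auto
  qed
qed

text \<open>
  Suppose every maximum matching misses two vertices. On the set \<open>D\<close> of vertices missed by some maximum
  matching, not being missed simultaneously (the negation of \<open>R\<close>) is an equivalence relation by Gallai's
  lemma, with classes \<open>K x\<close>, and no edge joins different classes, since it would enlarge a matching. Rotations and the
  expansion of small sets force \<open>card D \<ge> 3 * s\<close>. As large sets are joined by edges, \<open>D\<close> cannot be cut into
  two large unions of classes, so one class contains all but fewer than \<open>s\<close> vertices of \<open>D\<close>. Now let a
  maximum matching miss a vertex \<open>u\<close> of this class and some further vertex \<open>w\<close>. All endpoints of rotations
  from \<open>w\<close> that keep \<open>u\<close> exposed lie outside the class of \<open>u\<close>; they form a small set that does not expand.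
\<close>

theorem expanding_graph_near_perfect_matching:
  fixes X :: "'a set" and s :: nat
  assumes finX: "finite X" and two: "\<And>e. e \<in> G \<Longrightarrow> card e = 2" and GX: "\<And>e. e \<in> G \<Longrightarrow> e \<subseteq> X"
    and s: "s \<ge> 1"
    and large: "\<And>A B. A \<subseteq> X \<Longrightarrow> B \<subseteq> X \<Longrightarrow> A \<inter> B = {} \<Longrightarrow> s \<le> card A \<Longrightarrow> s \<le> card B \<Longrightarrow>
                 \<exists>x\<in>A. \<exists>y\<in>B. {x, y} \<in> G"
    and small: "\<And>B. B \<subseteq> X \<Longrightarrow> B \<noteq> {} \<Longrightarrow> card B < 3 * s \<Longrightarrow>
                 card B \<le> card ({y. \<exists>x\<in>B. {x, y} \<in> G} - B)"
  shows "\<exists>M. matching_in G M \<and> card (X - \<Union>M) \<le> 1"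
proof (rule ccontr)
  assume contr: "\<not> ?thesis"
  have finG: "finite G" using GX finX by (meson PowI finite_Pow_iff finite_subset subsetI)
  have fin_mat: "finite M" "\<Union>M \<subseteq> X" if "matching_in G M" for M
    using that finG GX finite_subset unfolding matching_in_def by blast+
  have "\<exists>M. matching_in G M \<and> (\<forall>M'. matching_in G M' \<longrightarrow> card M' \<le> card M)"
    by (rule ex_has_greatest_nat[of "matching_in G" "{}" card "Suc (card G)"])
       (use finG in \<open>auto simp: matching_in_def less_Suc_eq_le intro: card_mono\<close>)
  then obtain M0 where M0: "maximum_matching G M0" unfolding maximum_matching_def by blast
  have miss: "\<exists>w\<in>X - \<Union>M. w \<noteq> u" if "maximum_matching G M" for M u
  proof (rule ccontr)
    assume "\<not> ?thesis"
    then have "X - \<Union>M \<subseteq> {u}" by blast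
    then have "card (X - \<Union>M) \<le> 1" using card_mono[of "{u}"] by fastforce
    then show False using contr that unfolding maximum_matching_def by blast
  qed
  define D where "D = {x \<in> X. \<exists>M. maximum_matching G M \<and> x \<notin> \<Union>M}"
  define R where "R x y \<longleftrightarrow> x \<noteq> y \<and> (\<exists>M. maximum_matching G M \<and> x \<notin> \<Union>M \<and> y \<notin> \<Union>M)" for x y
  define K where "K x = {y \<in> D. \<not> R x y}" for x
  have DX: "D \<subseteq> X" and finD: "finite D" using finX unfolding D_def by auto
  have sym: "R x y \<Longrightarrow> R y x" for x y unfolding R_def by blast
  have split: "R u w \<or> R v w" if uv: "R u v" and w: "w \<in> D" for u v w
  proof -
    obtain M where M: "maximum_matching G M" "u \<notin> \<Union>M" "v \<notin> \<Union>M" "u \<noteq> v"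
      using uv unfolding R_def by blast
    obtain N where N: "maximum_matching G N" "w \<notin> \<Union>N" using w unfolding D_def by blast
    have mat: "matching_in G M" "matching_in G N"
      and le: "\<And>L. matching_in G L \<Longrightarrow> card L \<le> card M" "\<And>L. matching_in G L \<Longrightarrow> card L \<le> card N"
      using M(1) N(1) unfolding maximum_matching_def by simp_all
    have "card M = card N" using mat le by (simp add: le_antisym)
    from matching_missing_prescribed_vertex[OF finG two mat this refl le(2) M(2,3,4) N(2)]
    obtain L x where L: "matching_in G L" "card L = card N" "w \<notin> \<Union>L" "x \<notin> \<Union>L"
      "x \<in> {u, v}" "x \<noteq> w" by blast
    then have "maximum_matching G L" using N unfolding maximum_matching_def by simp
    then show ?thesis using L unfolding R_def by blast
  qed
  have nonadj: "{x, y} \<notin> G" if "R x y" for x y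
    using that maximum_matching_no_extension[OF finG] unfolding R_def by blast
  have cls: "R y z" if "y \<in> K x" "z \<in> D" "z \<notin> K x" for x y z
    using that split[of x z y] sym unfolding K_def by blast
  have selfK: "x \<in> K x" if "x \<in> D" for x using that unfolding K_def R_def by blast
  have rot: "\<exists>B. B \<noteq> {} \<and> B \<subseteq> {x \<in> D. R x v} \<and> 3 * s \<le> card B"
    if M: "maximum_matching G M" "u \<notin> \<Union>M" "v \<notin> \<Union>M" "u \<noteq> v" "u \<in> X" for M u v
  proof -
    define B where "B = {x. \<exists>M'. rotations G M u M' x}"
    have X: "x \<in> X" if "rotations G M u M' x" for M' x
      using that
    proof (cases rule: rotations.cases)
      case start then show ?thesis using M by simp
    next
      case (rotate M'' x' y)
      have "maximum_matching G M''"
        using rotations_maximum[OF finG two M(1-4) rotate(2)] by blast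
      then have "{y, x} \<in> G" using rotate unfolding maximum_matching_def matching_in_def by blast
      then show ?thesis using GX by blast
    qed
    have "u \<in> B" unfolding B_def using rotations.start by fast
    have sub: "B \<subseteq> {x \<in> D. R x v}"
    proof
      fix x assume "x \<in> B"
      then obtain M' where r: "rotations G M u M' x" unfolding B_def by blast
      show "x \<in> {x \<in> D. R x v}"
        using rotations_maximum[OF finG two M(1-4) r] X[OF r] unfolding D_def R_def by blast
    qed
    have finB: "finite B" using sub finD by (simp add: finite_subset)
    have "card ({y. \<exists>x\<in>B. {x, y} \<in> G} - B) < card B"
      using rotation_endpoints_poorly_expanding[OF finG two M(1-4)] finB unfolding B_def by blast
    then have "3 * s \<le> card B"
      using small[of B] sub DX \<open>u \<in> B\<close> by fastforce
    then show ?thesis using sub \<open>u \<in> B\<close> by blast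
  qed
  obtain u0 where u0: "u0 \<in> X - \<Union>M0" using miss[OF M0] by blast
  obtain v0 where v0: "v0 \<in> X - \<Union>M0" "v0 \<noteq> u0" using miss[OF M0] by blast
  have D3: "3 * s \<le> card D"
  proof -
    obtain B where "B \<subseteq> {x \<in> D. R x v0}" "3 * s \<le> card B"
      using rot[OF M0, of u0 v0] u0 v0 by blast
    moreover from this have "card B \<le> card D" using finD by (intro card_mono) auto
    ultimately show ?thesis by linarith
  qed
  have separated: False
    if A: "A \<subseteq> D" "\<And>x. x \<in> A \<Longrightarrow> K x \<subseteq> A" "s \<le> card A" "s \<le> card (D - A)" for A
  proof -
    obtain x y where "x \<in> A" "y \<in> D - A" "{x, y} \<in> G"
      using large[of A "D - A"] A DX by blast
    moreover from this have "R x y" using that cls[of x x y] selfK by blast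
    ultimately show False using nonadj by blast
  qed
  have closedK: "K y \<subseteq> K x" if "y \<in> K x" for x y
    using that cls unfolding K_def by blast
  \<comment> \<open>Otherwise a minimal union of classes of size at least \<open>s\<close> has size below \<open>2 * s\<close>, and both it and
     its complement in \<open>D\<close> are large.\<close>
  have "\<exists>x\<in>D. card (D - K x) < s"
  proof (rule ccontr)
    assume "\<not> ?thesis"
    then have big: "s \<le> card (D - K x)" if "x \<in> D" for x using that by force
    have smallK: "card (K x) < s" if "x \<in> D" for x
    proof (rule ccontr)
      assume "\<not> ?thesis"
      then show False using separated[of "K x"] big[OF that] closedK unfolding K_def by force
    qed
    define P where "P A \<longleftrightarrow> A \<subseteq> D \<and> (\<forall>x\<in>A. K x \<subseteq> A) \<and> s \<le> card A" for A
    have "P D" unfolding P_def K_def using D3 by auto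
    then obtain A where A: "P A" "\<And>A'. P A' \<Longrightarrow> card A \<le> card A'"
      using ex_has_least_nat[of P D card] by blast
    have finA: "finite A" using A finD finite_subset unfolding P_def by blast
    obtain x where x: "x \<in> A" using A(1) s unfolding P_def by fastforce
    have xD: "x \<in> D" using x A unfolding P_def by blast
    have KA: "K x \<subseteq> A" using A x unfolding P_def by blast
    have "K y \<subseteq> A - K x" if "y \<in> A - K x" for y
    proof
      fix z assume z: "z \<in> K y"
      have "z \<in> A" using A(1) z that unfolding P_def by blast
      moreover have "z \<notin> K x"
        using cls[of z x y] that z A(1) sym unfolding K_def P_def by blast
      ultimately show "z \<in> A - K x" by blast
    qed
    moreover have "card (A - K x) < card A"
      using x selfK[OF xD] finA by (intro psubset_card_mono) auto
    ultimately have "card (A - K x) < s" using A unfolding P_def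
      by (meson Diff_subset leD leI subset_trans)
    moreover have "card (A - K x) = card A - card (K x)"
      using KA finA by (meson card_Diff_subset finite_subset)
    ultimately have "card A < 2 * s" using smallK[OF xD] by linarith
    moreover have "card (D - A) = card D - card A"
      using A(1) finA unfolding P_def by (meson card_Diff_subset)
    ultimately have "s \<le> card (D - A)" using D3 by linarith
    then show False using separated[of A] A(1) unfolding P_def by blast
  qed
  then obtain u where u: "u \<in> D" "card (D - K u) < s" by blast
  obtain M where M: "maximum_matching G M" "u \<notin> \<Union>M" using u unfolding D_def by blast
  obtain w where w: "w \<in> X - \<Union>M" "w \<noteq> u" using miss[OF M(1)] by blast
  obtain B where B: "B \<subseteq> {x \<in> D. R x u}" "3 * s \<le> card B"
    using rot[OF M(1), of w u] M w by blast
  have "B \<subseteq> D - K u" using B sym unfolding K_def by blast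
  then have "card B \<le> card (D - K u)" using finD by (intro card_mono) auto
  then show False using u B by linarith
qed

section \<open>Random subsets\<close>

definition subset_weight :: "real \<Rightarrow> 'a set \<Rightarrow> 'a set \<Rightarrow> real" where
  "subset_weight q U S = q ^ card S * (1 - q) ^ card (U - S)"

text \<open>
  The law of a random subset of \<open>U\<close> that contains every element independently with probability \<open>q\<close>,
  written as a finite sum so that planting and exponential moments become identities between sums.
\<close>

definition subset_expectation :: "real \<Rightarrow> 'a set \<Rightarrow> ('a set \<Rightarrow> real) \<Rightarrow> real" where
  "subset_expectation q U f = (\<Sum>S\<in>Pow U. subset_weight q U S * f S)"

abbreviation subset_prob :: "real \<Rightarrow> 'a set \<Rightarrow> ('a set \<Rightarrow> bool) \<Rightarrow> real" where
  "subset_prob q U Q \<equiv> subset_expectation q U (\<lambda>S. of_bool (Q S))"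

lemma subset_weight_nonneg: "0 \<le> q \<Longrightarrow> q \<le> 1 \<Longrightarrow> 0 \<le> subset_weight q U S"
  unfolding subset_weight_def by simp

lemma subset_expectation_mono:
  assumes "0 \<le> q" "q \<le> 1" "\<And>S. S \<subseteq> U \<Longrightarrow> f S \<le> g S"
  shows "subset_expectation q U f \<le> subset_expectation q U g"
  unfolding subset_expectation_def using assms
  by (intro sum_mono mult_left_mono subset_weight_nonneg) auto

lemma subset_expectation_cong:
  assumes "\<And>S. S \<subseteq> U \<Longrightarrow> f S = g S"
  shows "subset_expectation q U f = subset_expectation q U g"
  unfolding subset_expectation_def using assms by (intro sum.cong) auto

lemma subset_expectation_add:
  "subset_expectation q U (\<lambda>S. f S + g S) = subset_expectation q U f + subset_expectation q U g"
  unfolding subset_expectation_def by (simp add: distrib_left sum.distrib)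

lemma subset_expectation_diff:
  "subset_expectation q U (\<lambda>S. f S - g S) = subset_expectation q U f - subset_expectation q U g"
  unfolding subset_expectation_def by (simp add: right_diff_distrib sum_subtractf)

lemma subset_expectation_cmult:
  "subset_expectation q U (\<lambda>S. c * f S) = c * subset_expectation q U f"
  unfolding subset_expectation_def by (simp add: sum_distrib_left mult.left_commute)

lemma subset_expectation_sum:
  "subset_expectation q U (\<lambda>S. \<Sum>i\<in>I. f i S) = (\<Sum>i\<in>I. subset_expectation q U (f i))"
  unfolding subset_expectation_def by (simp add: sum_distrib_left) (rule sum.swap)

lemma subset_expectation_insert:
  assumes "finite U" "e \<notin> U"
  shows "subset_expectation q (insert e U) f
    = q * subset_expectation q U (\<lambda>S. f (insert e S)) + (1 - q) * subset_expectation q U f"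
proof -
  have inj: "inj_on (insert e) (Pow U)" using assms(2) by (intro inj_onI) (metis Diff_insert_absorb PowD subsetD)
  have w1: "subset_weight q (insert e U) (insert e S) = q * subset_weight q U S" if "S \<in> Pow U" for S
  proof -
    have "finite S" "e \<notin> S" using that assms finite_subset by auto
    moreover have "insert e U - insert e S = U - S" using assms that by auto
    ultimately show ?thesis unfolding subset_weight_def by simp
  qed
  have w2: "subset_weight q (insert e U) S = (1 - q) * subset_weight q U S" if "S \<in> Pow U" for S
  proof -
    have "e \<notin> S" using that assms by auto
    then have "insert e U - S = insert e (U - S)" by auto
    then show ?thesis unfolding subset_weight_def using assms by simp
  qed
  have "subset_expectation q (insert e U) f
      = (\<Sum>S\<in>Pow U. subset_weight q (insert e U) S * f S)
        + (\<Sum>S\<in>insert e ` Pow U. subset_weight q (insert e U) S * f S)"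
    unfolding subset_expectation_def Pow_insert
    by (rule sum.union_disjoint) (use assms in auto)
  also have "(\<Sum>S\<in>insert e ` Pow U. subset_weight q (insert e U) S * f S)
     = (\<Sum>S\<in>Pow U. q * (subset_weight q U S * f (insert e S)))"
    using w1 by (simp add: sum.reindex[OF inj] mult.assoc)
  also have "(\<Sum>S\<in>Pow U. subset_weight q (insert e U) S * f S)
     = (\<Sum>S\<in>Pow U. (1 - q) * (subset_weight q U S * f S))"
    using w2 by (simp add: mult.assoc)
  finally show ?thesis unfolding subset_expectation_def
    by (simp add: sum_distrib_left)
qed

lemma subset_expectation_empty [simp]: "subset_expectation q {} f = f {}"
  unfolding subset_expectation_def subset_weight_def by simp

lemma subset_expectation_const:
  assumes "finite U"
  shows "subset_expectation q U (\<lambda>_. c) = c"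
  using assms by (induction U) (simp_all add: subset_expectation_insert algebra_simps)

lemma subset_expectation_exp_card_Int:
  assumes "finite U" "F \<subseteq> U"
  shows "subset_expectation q U (\<lambda>S. exp (\<theta> * real (card (F \<inter> S)))) = (1 + q * (exp \<theta> - 1)) ^ card F"
  using assms
proof (induction U arbitrary: F)
  case (insert e U)
  show ?case
  proof (cases "e \<in> F")
    case True
    define F' where "F' = F - {e}"
    have F: "F = insert e F'" "e \<notin> F'" "F' \<subseteq> U" "finite F'"
      using True insert.prems insert.hyps finite_subset unfolding F'_def by auto
    have 1: "card (F \<inter> insert e S) = Suc (card (F' \<inter> S))" if "S \<subseteq> U" for S
    proof -
      have "F \<inter> insert e S = insert e (F' \<inter> S)" using F by auto
      then show ?thesis using F by simp
    qed
    have 2: "F \<inter> S = F' \<inter> S" if "S \<subseteq> U" for S using that F insert.hyps by auto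
    have "subset_expectation q U (\<lambda>S. exp (\<theta> * real (card (F \<inter> insert e S))))
       = subset_expectation q U (\<lambda>S. exp \<theta> * exp (\<theta> * real (card (F' \<inter> S))))"
      by (rule subset_expectation_cong) (simp add: 1 algebra_simps exp_add)
    moreover have "subset_expectation q U (\<lambda>S. exp (\<theta> * real (card (F \<inter> S))))
       = subset_expectation q U (\<lambda>S. exp (\<theta> * real (card (F' \<inter> S))))"
      by (rule subset_expectation_cong) (simp add: 2)
    moreover have "card F = Suc (card F')" using F by simp
    ultimately show ?thesis
      using insert.hyps insert.IH[OF F(3)]
      by (simp add: subset_expectation_insert subset_expectation_cmult algebra_simps)
  next
    case False
    then have "F \<subseteq> U" using insert.prems by auto
    moreover have "F \<inter> insert e S = F \<inter> S" for S using False by auto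
    ultimately show ?thesis
      using insert.hyps insert.IH by (simp add: subset_expectation_insert algebra_simps)
  qed
qed simp

text \<open>
  Planting \<open>F\<close> is the same as conditioning on \<open>F\<close> being present: the elements outside \<open>F\<close> are unaffected by
  either operation.
\<close>

lemma subset_expectation_union:
  assumes "finite U" "F \<subseteq> U"
  shows "q ^ card F * subset_expectation q U (\<lambda>S. f (S \<union> F))
    = subset_expectation q U (\<lambda>S. f S * of_bool (F \<subseteq> S))"
  using assms
proof (induction U arbitrary: F f)
  case (insert e U)
  show ?case
  proof (cases "e \<in> F")
    case True
    define F' where "F' = F - {e}"
    have F: "F = insert e F'" "e \<notin> F'" "F' \<subseteq> U" "finite F'"
      using True insert.prems insert.hyps finite_subset unfolding F'_def by auto
    have 1: "subset_expectation q U (\<lambda>S. f S * of_bool (F \<subseteq> S)) = 0"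
      unfolding subset_expectation_def using True insert.hyps by (intro sum.neutral) auto
    have 2: "subset_expectation q U (\<lambda>S. f (insert e S) * of_bool (F \<subseteq> insert e S))
       = subset_expectation q U (\<lambda>S. f (insert e S) * of_bool (F' \<subseteq> S))"
      using F insert.hyps by (intro subset_expectation_cong) auto
    have 3: "q ^ card F' * subset_expectation q U (\<lambda>S. f (insert e (S \<union> F')))
       = subset_expectation q U (\<lambda>S. f (insert e S) * of_bool (F' \<subseteq> S))"
      by (rule insert.IH[OF F(3), of "\<lambda>S. f (insert e S)"])
    have 4: "S \<union> F = insert e (S \<union> F')" "insert e S \<union> F = insert e (S \<union> F')" for S using F by auto
    have "card F = Suc (card F')" using F by simp
    then show ?thesis
      unfolding subset_expectation_insert[OF insert.hyps(1,2)] 1 2 3[symmetric] 4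
      by (simp add: algebra_simps)
  next
    case False
    then have F: "F \<subseteq> U" using insert.prems by auto
    moreover have "F \<subseteq> insert e S \<longleftrightarrow> F \<subseteq> S" for S using False by auto
    moreover have "insert e S \<union> F = insert e (S \<union> F)" for S by auto
    ultimately show ?thesis
      unfolding subset_expectation_insert[OF insert.hyps(1,2)]
      using insert.IH[OF F, of f] insert.IH[OF F, of "\<lambda>S. f (insert e S)"]
      by (simp add: algebra_simps)
  qed
qed simp

lemma subset_prob_superset:
  assumes "finite U" "F \<subseteq> U"
  shows "subset_prob q U (\<lambda>S. F \<subseteq> S) = q ^ card F"
  using subset_expectation_union[OF assms, of q "\<lambda>_. 1"] subset_expectation_const[OF assms(1), of q 1]
  by simp

lemma one_plus_power_le_exp:
  fixes x :: real
  assumes "-1 \<le> x" shows "(1 + x) ^ m \<le> exp (real m * x)"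
proof -
  have "(1 + x) ^ m \<le> exp x ^ m" using assms exp_ge_add_one_self[of x] by (intro power_mono) auto
  then show ?thesis by (simp add: exp_of_nat_mult)
qed

lemma subset_expectation_exp_bound:
  assumes "finite U" "F \<subseteq> U" "0 \<le> q" "q \<le> 1"
  shows "subset_expectation q U (\<lambda>S. exp (\<theta> * real (card (F \<inter> S)))) \<le> exp (real (card F) * (q * (exp \<theta> - 1)))"
proof -
  have "q * (1 - exp \<theta>) \<le> 1"
    using assms mult_mono[of q 1 "1 - exp \<theta>" 1] 
    by (cases "exp \<theta> \<le> 1") (auto intro: order_trans[OF mult_nonneg_nonpos])
  then have "-1 \<le> q * (exp \<theta> - 1)" by (simp add: algebra_simps)
  then show ?thesis
    unfolding subset_expectation_exp_card_Int[OF assms(1,2)] by (rule one_plus_power_le_exp)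
qed

lemma exp_1_le: "exp (1::real) \<le> 3" "exp (-1::real) \<le> 1/2"
proof -
  show "exp (1::real) \<le> 3" by (rule exp_le)
  have "exp (1::real) \<ge> 2" using exp_ge_add_one_self[of "1::real"] by simp
  then show "exp (-1::real) \<le> 1/2" by (simp add: exp_minus field_simps)
qed

text \<open>
  Chernoff's argument with the exponential parameter fixed at \<open>1\<close> (and at \<open>-1\<close> for the lower tail):
  the constants in the exponents are not optimal, but the bounds are free of logarithms.
\<close>

lemma subset_prob_upper_tail:
  assumes "finite U" "F \<subseteq> U" "0 \<le> q" "q \<le> 1"
  shows "subset_prob q U (\<lambda>S. t \<le> real (card (F \<inter> S))) \<le> exp (2 * q * real (card F) - t)"
proof -
  have "subset_prob q U (\<lambda>S. t \<le> real (card (F \<inter> S)))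
     \<le> subset_expectation q U (\<lambda>S. exp (-t) * exp (1 * real (card (F \<inter> S))))"
    using assms by (intro subset_expectation_mono) (auto simp flip: exp_add)
  also have "\<dots> \<le> exp (-t) * exp (real (card F) * (q * (exp 1 - 1)))"
    unfolding subset_expectation_cmult
    using subset_expectation_exp_bound[OF assms, of 1] by simp
  also have "real (card F) * (q * (exp 1 - 1)) \<le> real (card F) * (q * 2)"
    using assms exp_1_le(1) by (intro mult_left_mono) auto
  finally show ?thesis by (simp flip: exp_add add: algebra_simps)
qed

lemma subset_prob_lower_tail:
  assumes "finite U" "F \<subseteq> U" "0 \<le> q" "q \<le> 1"
  shows "subset_prob q U (\<lambda>S. real (card (F \<inter> S)) \<le> t) \<le> exp (t - q * real (card F) / 2)"
proof -
  have "subset_prob q U (\<lambda>S. real (card (F \<inter> S)) \<le> t)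
     \<le> subset_expectation q U (\<lambda>S. exp t * exp ((-1) * real (card (F \<inter> S))))"
    using assms by (intro subset_expectation_mono) (auto simp flip: exp_add)
  also have "\<dots> \<le> exp t * exp (real (card F) * (q * (exp (-1) - 1)))"
    unfolding subset_expectation_cmult
    using subset_expectation_exp_bound[OF assms, of "-1"] by simp
  also have "real (card F) * (q * (exp (-1) - 1)) \<le> real (card F) * (q * (-1/2))"
    using assms exp_1_le(2) by (intro mult_left_mono) auto
  finally show ?thesis by (simp flip: exp_add add: algebra_simps)
qed

lemma subset_prob_union_bound:
  assumes "finite I" "0 \<le> q" "q \<le> 1" 
  shows "subset_prob q U (\<lambda>S. \<exists>i\<in>I. Q i S) \<le> (\<Sum>i\<in>I. subset_prob q U (Q i))"
  unfolding subset_expectation_sum[symmetric]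
proof (rule subset_expectation_mono)
  fix S
  show "of_bool (\<exists>i\<in>I. Q i S) \<le> (\<Sum>i\<in>I. of_bool (Q i S) :: real)"
  proof (cases "\<exists>i\<in>I. Q i S")
    case True
    then obtain i where i: "i \<in> I" "Q i S" by blast
    then have "(of_bool (Q i S) :: real) \<le> (\<Sum>i\<in>I. of_bool (Q i S))"
      using assms by (intro member_le_sum) auto
    then show ?thesis using i True by simp
  qed (auto intro: sum_nonneg)
qed (use assms in auto)

text \<open>
  A single term of the binomial expansion of \<open>(1 + e r) ^ m\<close>; it bounds the expected number of
  \<open>k\<close>-subsets of \<open>m\<close> events when each \<open>k\<close>-subset occurs with probability \<open>r ^ k\<close>.
\<close>

lemma binomial_power_le_exp:
  assumes "0 \<le> r"
  shows "real (m choose k) * r ^ k \<le> exp (3 * real m * r - real k)"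
proof (cases "k \<le> m")
  case True
  have "real (m choose k) * (exp 1 * r) ^ k \<le> (\<Sum>j\<le>m. real (m choose j) * (exp 1 * r) ^ j)"
    using True assms by (intro member_le_sum) auto
  also have "\<dots> = (exp 1 * r + 1) ^ m" by (simp add: binomial_ring)
  also have "\<dots> \<le> exp (real m * (exp 1 * r))"
    using one_plus_power_le_exp[of "exp 1 * r" m] assms
    by (simp add: add.commute order_trans[OF _ mult_nonneg_nonneg])
  also have "\<dots> \<le> exp (real m * (3 * r))"
    using assms exp_1_le by (auto intro!: mult_left_mono mult_right_mono)
  finally have "real (m choose k) * r ^ k * exp (real k) \<le> exp (3 * real m * r)"
    by (simp add: power_mult_distrib exp_of_nat_mult[symmetric] algebra_simps)
  then show ?thesis by (simp add: exp_diff field_simps)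
qed (simp add: binomial_eq_0)

lemma subset_expectation_abs_le_sqrt:
  assumes "finite U" "0 \<le> q" "q \<le> 1"
  shows "subset_expectation q U (\<lambda>S. \<bar>f S\<bar>) \<le> sqrt (subset_expectation q U (\<lambda>S. (f S)\<^sup>2))"
proof -
  define m where "m = subset_expectation q U (\<lambda>S. \<bar>f S\<bar>)"
  have "0 = subset_expectation q U (\<lambda>_. 0)" using subset_expectation_const[OF assms(1)] by metis
  also have "\<dots> \<le> subset_expectation q U (\<lambda>S. (\<bar>f S\<bar> - m)\<^sup>2)"
    using assms by (intro subset_expectation_mono) auto
  also have "\<dots> = subset_expectation q U (\<lambda>S. ((f S)\<^sup>2 - (2 * m) * \<bar>f S\<bar>) + m\<^sup>2)"
    by (rule subset_expectation_cong) (simp add: power2_diff)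
  also have "\<dots> = subset_expectation q U (\<lambda>S. (f S)\<^sup>2) - m\<^sup>2"
    unfolding subset_expectation_add subset_expectation_diff subset_expectation_cmult
      subset_expectation_const[OF assms(1)] m_def[symmetric]
    by (simp add: power2_eq_square)
  finally have "m\<^sup>2 \<le> subset_expectation q U (\<lambda>S. (f S)\<^sup>2)" by simp
  then show ?thesis unfolding m_def by (rule real_le_rsqrt)
qed

lemma gnp_complement_prob:
  assumes "0 \<le> q" "q \<le> 1"
  shows "measure_pmf.prob (gnp n (1 - q)) {E. Q E}
    = subset_prob q (nsets {..<n} 2) (\<lambda>H. Q (nsets {..<n} 2 - H))"
proof -
  define U where "U = nsets {..<n} 2"
  have U: "finite U" unfolding U_def by (simp add: finite_imp_finite_nsets)
  define P where "P = Pi_pmf U False (\<lambda>_. bernoulli_pmf (1 - q))"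
  define g where "g X = {e \<in> U. X e}" for X :: "nat set \<Rightarrow> bool"
  have G: "gnp n (1 - q) = map_pmf g P" unfolding gnp_def g_def P_def U_def ..
  have out: "pmf P X = 0" if "\<exists>e. e \<notin> U \<and> X e" for X
    using that unfolding P_def pmf_Pi[OF U] by auto
  have pm: "pmf (gnp n (1 - q)) E = subset_weight q U (U - E)" if E: "E \<subseteq> U" for E
  proof -
    have "pmf (gnp n (1 - q)) E = measure P (g -` {E})" unfolding G pmf_map ..
    also have "\<dots> = measure P {\<lambda>e. e \<in> E}"
    proof (rule measure_prob_cong_0)
      fix X assume X: "X \<in> g -` {E} - {\<lambda>e. e \<in> E}"
      then obtain e where "X e \<noteq> (e \<in> E)" by auto
      then have "e \<notin> U \<and> X e" using X E unfolding g_def by auto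
      then show "pmf P X = 0" using out by blast
    next
      fix X assume "X \<in> {\<lambda>e. e \<in> E} - g -` {E}"
      then show "pmf P X = 0" using E unfolding g_def by auto
    qed
    also have "\<dots> = (\<Prod>e\<in>U. pmf (bernoulli_pmf (1 - q)) (e \<in> E))"
      using E unfolding measure_pmf_single P_def pmf_Pi[OF U] by auto
    also have "\<dots> = (\<Prod>e\<in>U. if e \<in> E then 1 - q else q)"
      using assms by (intro prod.cong) auto
    also have "\<dots> = (1 - q) ^ card (U \<inter> E) * q ^ card (U - E)"
      using U by (simp add: prod.If_cases Diff_eq Collect_neg_eq)
    also have "U \<inter> E = U - (U - E)" by auto
    finally show ?thesis unfolding subset_weight_def by simp
  qed
  have out': "pmf (gnp n (1 - q)) E = 0" if "\<not> E \<subseteq> U" for E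
  proof -
    have "g -` {E} = {}" using that unfolding g_def by auto
    then show ?thesis unfolding G pmf_map by simp
  qed
  have "measure_pmf.prob (gnp n (1 - q)) {E. Q E} = measure_pmf.prob (gnp n (1 - q)) {E \<in> Pow U. Q E}"
    by (rule measure_prob_cong_0) (use out' in auto)
  also have "\<dots> = (\<Sum>E\<in>{E \<in> Pow U. Q E}. pmf (gnp n (1 - q)) E)"
    using U by (intro measure_measure_pmf_finite) auto
  also have "\<dots> = (\<Sum>E\<in>{E \<in> Pow U. Q E}. subset_weight q U (U - E))"
    using pm by (intro sum.cong) auto
  also have "\<dots> = (\<Sum>E\<in>Pow U. subset_weight q U (U - E) * of_bool (Q E))"
    using U by (intro sum.mono_neutral_cong_left) auto
  also have "\<dots> = (\<Sum>H\<in>Pow U. subset_weight q U H * of_bool (Q (U - H)))"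
    by (rule sum.reindex_bij_witness[of _ "\<lambda>E. U - E" "\<lambda>E. U - E"]) (auto simp: double_diff)
  finally show ?thesis unfolding subset_expectation_def U_def .
qed

section \<open>Anticoncentration by planting\<close>

text \<open>
  Planting a random member of a family moves \<open>\<Phi>\<close> up by one, except with probability \<open>b\<close>, whereas the law
  of the random set changes by the density \<open>L\<close>, whose variance is at most \<open>v\<close> by the second moment
  hypothesis. The function \<open>h \<circ> \<Phi>\<close>, with \<open>h\<close> truncating to the window \<open>[a, a + l]\<close>, takes values in an
  interval of length \<open>l\<close>; after centring at \<open>l / 2\<close> its expectation can change by at most
  \<open>l / 2 * sqrt v\<close>. Being inside the window with room for one more step contributes a full unit.
\<close>

theorem planting_anticoncentration:
  fixes F :: "'i \<Rightarrow> 'a set" and \<Phi> :: "'a set \<Rightarrow> real"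
  assumes U: "finite U" and q: "0 < q" "q \<le> 1"
    and I: "finite I" "I \<noteq> {}" and F: "\<And>i. i \<in> I \<Longrightarrow> F i \<subseteq> U" "\<And>i. i \<in> I \<Longrightarrow> card (F i) = k"
    and mono: "\<And>S i. S \<subseteq> U \<Longrightarrow> i \<in> I \<Longrightarrow> \<Phi> S \<le> \<Phi> (S \<union> F i)"
    and bad: "\<And>S. S \<subseteq> U \<Longrightarrow> real (card {i \<in> I. \<Phi> (S \<union> F i) < \<Phi> S + 1}) \<le> real (card I) * b S"
    and second: "(\<Sum>i\<in>I. \<Sum>j\<in>I. (1 / q) ^ card (F i \<inter> F j)) \<le> (1 + v) * (real (card I))\<^sup>2"
    and l: "0 \<le> l"
  shows "subset_prob q U (\<lambda>S. a \<le> \<Phi> S \<and> \<Phi> S \<le> a + l - 1) \<le> subset_expectation q U b + l / 2 * sqrt v"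
proof -
  define N where "N = real (card I)"
  have N: "N > 0" using I by (simp add: N_def card_gt_0_iff)
  define h where "h x = max 0 (min l (x - a))" for x :: real
  define L where "L S = (\<Sum>i\<in>I. of_bool (F i \<subseteq> S)) / (N * q ^ k)" for S
  have q01: "0 \<le> q" "q \<le> 1" using q by auto
  note const = subset_expectation_const[OF U, of q]
  have EL: "subset_expectation q U L = 1"
  proof -
    have "subset_expectation q U L = (\<Sum>i\<in>I. subset_prob q U (\<lambda>S. F i \<subseteq> S)) / (N * q ^ k)"
      unfolding L_def divide_inverse mult.commute[of _ "inverse _"] subset_expectation_cmult
        subset_expectation_sum ..
    also have "\<dots> = (\<Sum>i\<in>I. q ^ k) / (N * q ^ k)"
      using F by (simp add: subset_prob_superset[OF U])
    finally show ?thesis using q N by (simp add: N_def)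
  qed
  have EL2: "subset_expectation q U (\<lambda>S. (L S)\<^sup>2) \<le> 1 + v"
  proof -
    have pair: "subset_prob q U (\<lambda>S. F i \<subseteq> S \<and> F j \<subseteq> S) = q ^ (2 * k) * (1 / q) ^ card (F i \<inter> F j)"
      if ij: "i \<in> I" "j \<in> I" for i j
    proof -
      have fin: "finite (F i)" "finite (F j)" using F(1) ij U finite_subset by blast+
      have "subset_prob q U (\<lambda>S. F i \<subseteq> S \<and> F j \<subseteq> S) = q ^ card (F i \<union> F j)"
        using subset_prob_superset[OF U, of "F i \<union> F j" q] F(1) ij by (simp add: Un_subset_iff)
      moreover have "card (F i \<union> F j) + card (F i \<inter> F j) = 2 * k"
        using card_Un_Int[OF fin] F(2) ij by simp
      then have "q ^ (2 * k) = q ^ card (F i \<union> F j) * q ^ card (F i \<inter> F j)"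
        by (metis power_add)
      ultimately show ?thesis using q by (simp add: power_divide)
    qed
    have "subset_expectation q U (\<lambda>S. (L S)\<^sup>2)
       = subset_expectation q U (\<lambda>S. 1 / (N * q ^ k)\<^sup>2 * (\<Sum>i\<in>I. \<Sum>j\<in>I. of_bool (F i \<subseteq> S \<and> F j \<subseteq> S)))"
      unfolding L_def
      by (rule subset_expectation_cong) (simp add: power_divide power2_eq_square sum_product of_bool_conj)
    also have "\<dots> = 1 / (N * q ^ k)\<^sup>2 * (\<Sum>i\<in>I. \<Sum>j\<in>I. q ^ (2 * k) * (1 / q) ^ card (F i \<inter> F j))"
      unfolding subset_expectation_cmult subset_expectation_sum
      using pair by simp
    also have "\<dots> = 1 / (N * q ^ k)\<^sup>2 * (q ^ (2 * k) * (\<Sum>i\<in>I. \<Sum>j\<in>I. (1 / q) ^ card (F i \<inter> F j)))"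
      by (simp add: sum_distrib_left)
    also have "\<dots> \<le> 1 / (N * q ^ k)\<^sup>2 * (q ^ (2 * k) * ((1 + v) * N\<^sup>2))"
      using second q unfolding N_def by (intro mult_left_mono) auto
    also have "\<dots> = 1 + v" using N q by (simp add: power_mult_distrib power_mult[symmetric] mult.commute)
    finally show ?thesis .
  qed
  have "subset_expectation q U (\<lambda>S. (L S - 1)\<^sup>2)
      = subset_expectation q U (\<lambda>S. ((L S)\<^sup>2 - 2 * L S) + 1)"
    by (rule subset_expectation_cong) (simp add: power2_diff)
  also have "\<dots> \<le> v"
    unfolding subset_expectation_add subset_expectation_diff subset_expectation_cmult const EL
    using EL2 by simp
  finally have var: "subset_expectation q U (\<lambda>S. \<bar>L S - 1\<bar>) \<le> sqrt v"
    using subset_expectation_abs_le_sqrt[OF U q01, of "\<lambda>S. L S - 1"]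
    by (meson order_trans real_sqrt_le_mono)
  have planted: "(\<Sum>i\<in>I. subset_expectation q U (\<lambda>S. h (\<Phi> (S \<union> F i))))
      = N * subset_expectation q U (\<lambda>S. h (\<Phi> S) * L S)"
  proof -
    have "subset_expectation q U (\<lambda>S. h (\<Phi> (S \<union> F i)))
        = 1 / q ^ k * subset_expectation q U (\<lambda>S. h (\<Phi> S) * of_bool (F i \<subseteq> S))" if "i \<in> I" for i
      using subset_expectation_union[OF U F(1)[OF that], of q "\<lambda>S. h (\<Phi> S)"] F(2)[OF that] q
      by (simp add: field_simps)
    then have "(\<Sum>i\<in>I. subset_expectation q U (\<lambda>S. h (\<Phi> (S \<union> F i))))
        = (\<Sum>i\<in>I. subset_expectation q U (\<lambda>S. 1 / q ^ k * (h (\<Phi> S) * of_bool (F i \<subseteq> S))))"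
      unfolding subset_expectation_cmult by simp
    also have "\<dots> = subset_expectation q U (\<lambda>S. N * (h (\<Phi> S) * L S))"
      unfolding subset_expectation_sum[symmetric] L_def using N
      by (intro subset_expectation_cong) (simp add: sum_distrib_left sum_divide_distrib mult_ac)
    finally show ?thesis unfolding subset_expectation_cmult .
  qed
  \<comment> \<open>Truncation keeps \<open>h\<close> monotone and lets a unit step count in full inside the window.\<close>
  have gain: "N * (h (\<Phi> S) + of_bool (a \<le> \<Phi> S \<and> \<Phi> S \<le> a + l - 1) - b S)
      \<le> (\<Sum>i\<in>I. h (\<Phi> (S \<union> F i)))" if S: "S \<subseteq> U" for S
  proof -
    have hm: "h (\<Phi> S) \<le> h (\<Phi> (S \<union> F i))" if "i \<in> I" for i
      using mono[OF S that] unfolding h_def by auto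
    define Bd where "Bd = {i \<in> I. \<Phi> (S \<union> F i) < \<Phi> S + 1}"
    have Bd: "real (card Bd) \<le> N * b S" using bad[OF S] unfolding Bd_def N_def .
    have BI: "Bd \<subseteq> I" unfolding Bd_def by auto
    show ?thesis
    proof (cases "a \<le> \<Phi> S \<and> \<Phi> S \<le> a + l - 1")
      case True
      have step: "h (\<Phi> S) + of_bool (i \<notin> Bd) \<le> h (\<Phi> (S \<union> F i))" if "i \<in> I" for i
      proof (cases "i \<in> Bd")
        case False
        then have "\<Phi> S + 1 \<le> \<Phi> (S \<union> F i)" using that unfolding Bd_def by auto
        then show ?thesis using True False unfolding h_def by auto
      qed (use hm[OF that] in auto)
      have "(\<Sum>i\<in>I. of_bool (i \<notin> Bd) :: real) = N - real (card Bd)"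
      proof -
        have "(\<Sum>i\<in>I. of_bool (i \<notin> Bd) :: real) = real (card (I - Bd))"
          using I by (simp add: sum_of_bool_eq Diff_eq Collect_neg_eq)
        then show ?thesis using BI I N_def
          by (simp add: card_Diff_subset finite_subset card_mono of_nat_diff)
      qed
      then have "N * h (\<Phi> S) + (N - real (card Bd)) = (\<Sum>i\<in>I. h (\<Phi> S) + of_bool (i \<notin> Bd))"
        by (simp add: sum.distrib N_def)
      also have "\<dots> \<le> (\<Sum>i\<in>I. h (\<Phi> (S \<union> F i)))" using step by (rule sum_mono)
      finally show ?thesis using True Bd by (simp add: algebra_simps)
    next
      case False
      have "N * h (\<Phi> S) = (\<Sum>i\<in>I. h (\<Phi> S))" by (simp add: N_def)
      also have "\<dots> \<le> (\<Sum>i\<in>I. h (\<Phi> (S \<union> F i)))" using hm by (rule sum_mono)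
      finally have "N * h (\<Phi> S) \<le> (\<Sum>i\<in>I. h (\<Phi> (S \<union> F i)))" .
      moreover have "0 \<le> N * b S" using Bd by linarith
      moreover have "of_bool (a \<le> \<Phi> S \<and> \<Phi> S \<le> a + l - 1) = (0::real)" using False by auto
      ultimately show ?thesis by (simp only: distrib_left right_diff_distrib)
    qed
  qed
  define p where "p = subset_prob q U (\<lambda>S. a \<le> \<Phi> S \<and> \<Phi> S \<le> a + l - 1)"
  have "N * (subset_expectation q U (\<lambda>S. h (\<Phi> S)) + p - subset_expectation q U b)
     = subset_expectation q U (\<lambda>S. N * (h (\<Phi> S) + of_bool (a \<le> \<Phi> S \<and> \<Phi> S \<le> a + l - 1) - b S))"
    unfolding p_def subset_expectation_cmult subset_expectation_diff subset_expectation_add ..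
  also have "\<dots> \<le> subset_expectation q U (\<lambda>S. \<Sum>i\<in>I. h (\<Phi> (S \<union> F i)))"
    using gain q01 by (intro subset_expectation_mono) auto
  also have "\<dots> = N * subset_expectation q U (\<lambda>S. h (\<Phi> S) * L S)"
    unfolding subset_expectation_sum planted ..
  finally have "p \<le> subset_expectation q U (\<lambda>S. h (\<Phi> S) * L S) - subset_expectation q U (\<lambda>S. h (\<Phi> S))
      + subset_expectation q U b"
    using N by simp
  also have "subset_expectation q U (\<lambda>S. h (\<Phi> S) * L S) - subset_expectation q U (\<lambda>S. h (\<Phi> S))
      = subset_expectation q U (\<lambda>S. (h (\<Phi> S) * L S - h (\<Phi> S)) - l / 2 * (L S - 1))"
    unfolding subset_expectation_diff subset_expectation_cmult const EL by simp
  also have "\<dots> \<le> subset_expectation q U (\<lambda>S. l / 2 * \<bar>L S - 1\<bar>)"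
  proof (rule subset_expectation_mono[OF q01])
    fix S
    have "0 \<le> h (\<Phi> S) \<and> h (\<Phi> S) \<le> l" using l unfolding h_def by auto
    then have "\<bar>h (\<Phi> S) - l / 2\<bar> \<le> l / 2" by linarith
    then have "\<bar>(h (\<Phi> S) - l / 2) * (L S - 1)\<bar> \<le> l / 2 * \<bar>L S - 1\<bar>"
      unfolding abs_mult by (rule mult_right_mono) simp
    moreover have "h (\<Phi> S) * L S - h (\<Phi> S) - l / 2 * (L S - 1) = (h (\<Phi> S) - l / 2) * (L S - 1)"
      by (simp add: left_diff_distrib right_diff_distrib)
    ultimately show "h (\<Phi> S) * L S - h (\<Phi> S) - l / 2 * (L S - 1) \<le> l / 2 * \<bar>L S - 1\<bar>"
      by linarith
  qed
  also have "\<dots> \<le> l / 2 * sqrt v"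
    unfolding subset_expectation_cmult using var l by (intro mult_left_mono) auto
  finally show ?thesis unfolding p_def by simp
qed

section \<open>Colourings and triangle packings of the complement\<close>

definition triangle_packing :: "'a set \<Rightarrow> 'a set set \<Rightarrow> 'a set set \<Rightarrow> bool" where
  "triangle_packing V H P \<longleftrightarrow> P \<subseteq> nsets V 3 \<and> disjoint P \<and> (\<forall>t\<in>P. nsets t 2 \<subseteq> H)"

definition triangle_packing_number :: "'a set \<Rightarrow> 'a set set \<Rightarrow> nat" where
  "triangle_packing_number V H = Max (card ` {P. triangle_packing V H P})"

lemma finite_triangle_packings: "finite V \<Longrightarrow> finite {P. triangle_packing V H P}"
  unfolding triangle_packing_def
  by (rule finite_subset[of _ "Pow (nsets V 3)"]) (auto simp: finite_imp_finite_nsets)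

lemma card_le_triangle_packing_number:
  "finite V \<Longrightarrow> triangle_packing V H P \<Longrightarrow> card P \<le> triangle_packing_number V H"
  unfolding triangle_packing_number_def
  by (intro Max_ge finite_imageI finite_triangle_packings) auto

lemma obtain_maximum_triangle_packing:
  assumes "finite V"
  obtains P where "triangle_packing V H P" "card P = triangle_packing_number V H"
proof -
  have "triangle_packing V H {}" unfolding triangle_packing_def by auto
  then have "triangle_packing_number V H \<in> card ` {P. triangle_packing V H P}"
    unfolding triangle_packing_number_def using assms
    by (intro Max_in finite_imageI finite_triangle_packings) auto
  then show ?thesis using that by auto
qed

lemma triangle_packing_card_Union:
  assumes "finite V" "triangle_packing V H P"
  shows "card (\<Union>P) = 3 * card P"
proof -
  have "card (\<Union>P) = sum card P"
    using assms unfolding triangle_packing_def nsets_def by (intro card_Union_disjoint) auto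
  also have "\<dots> = sum (\<lambda>_. 3) P"
    using assms unfolding triangle_packing_def nsets_def by (intro sum.cong) auto
  finally show ?thesis by simp
qed

lemma doubleton_in_nsets_2: "u \<in> V \<Longrightarrow> v \<in> V \<Longrightarrow> u \<noteq> v \<Longrightarrow> {u, v} \<in> nsets V 2"
  unfolding nsets_def by auto

lemma nsets_2_cases:
  assumes "e \<in> nsets V 2" obtains u v where "e = {u, v}" "u \<noteq> v" "u \<in> V" "v \<in> V"
  using assms unfolding nsets_def by (auto simp: card_2_iff)

lemma chromatic_number_le_clique_cover:
  assumes C: "finite C" "V \<subseteq> \<Union>C" and clique: "\<And>c u v. c \<in> C \<Longrightarrow> u \<in> c \<Longrightarrow> v \<in> c \<Longrightarrow> u \<noteq> v \<Longrightarrow> {u, v} \<in> H"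
  shows "chromatic_number V (nsets V 2 - H) \<le> card C"
proof -
  obtain g :: "'a set \<Rightarrow> nat" where g: "bij_betw g C {..<card C}"
    using ex_bij_betw_finite_nat[OF C(1)] by (auto simp: atLeast0LessThan)
  have "\<forall>v\<in>V. \<exists>d. d \<in> C \<and> v \<in> d" using C(2) by blast
  from bchoice[OF this] obtain c where "\<forall>v\<in>V. c v \<in> C \<and> v \<in> c v" by blast
  then have c: "\<And>v. v \<in> V \<Longrightarrow> c v \<in> C \<and> v \<in> c v" by blast
  have "proper_colouring V (nsets V 2 - H) (card C) (g \<circ> c)"
    unfolding proper_colouring_def
  proof (intro conjI ballI impI)
    show "(g \<circ> c) v < card C" if "v \<in> V" for v using c[OF that] g by (auto dest: bij_betwE)
    fix u v assume uv: "u \<in> V" "v \<in> V" "{u, v} \<in> nsets V 2 - H"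
    then have "u \<noteq> v" unfolding nsets_def by auto
    show "(g \<circ> c) u \<noteq> (g \<circ> c) v"
    proof
      assume "(g \<circ> c) u = (g \<circ> c) v"
      then have "c u = c v" using g c uv by (auto dest: bij_betw_imp_inj_on inj_onD)
      then show False using clique[of "c u" u v] c uv \<open>u \<noteq> v\<close> by auto
    qed
  qed
  then show ?thesis unfolding chromatic_number_def by (blast intro: Least_le)
qed

lemma chromatic_number_colouring:
  assumes "finite V" "\<And>v. {v} \<notin> E"
  shows "\<exists>f. proper_colouring V E (chromatic_number V E) f"
proof -
  obtain g :: "'a \<Rightarrow> nat" where "bij_betw g V {..<card V}"
    using ex_bij_betw_finite_nat[OF assms(1)] by (auto simp: atLeast0LessThan)
  then have "proper_colouring V E (card V) g"
    using assms(2) unfolding proper_colouring_def bij_betw_def inj_on_def by fastforce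
  then show ?thesis
    unfolding chromatic_number_def using LeastI[of "\<lambda>k. \<exists>f. proper_colouring V E k f" "card V"] by blast
qed

text \<open>
  Colour classes are cliques of \<open>H\<close>, so they have at most three vertices, and those with exactly three
  form a triangle packing.
\<close>

lemma card_le_chromatic_number_plus_packing:
  assumes V: "finite V" and no4: "\<And>Q. Q \<in> nsets V 4 \<Longrightarrow> \<not> nsets Q 2 \<subseteq> H"
  shows "card V \<le> 2 * chromatic_number V (nsets V 2 - H) + triangle_packing_number V H"
proof -
  define k where "k = chromatic_number V (nsets V 2 - H)"
  obtain f where f: "proper_colouring V (nsets V 2 - H) k f"
    unfolding k_def using chromatic_number_colouring[OF V, of "nsets V 2 - H"]
    by (auto simp: nsets_def)
  define A where "A i = {v \<in> V. f v = i}" for i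
  have finA: "finite (A i)" for i using V unfolding A_def by auto
  have clique: "nsets (A i) 2 \<subseteq> H" for i
  proof
    fix e assume "e \<in> nsets (A i) 2"
    then obtain u v where e: "e = {u, v}" "u \<noteq> v" "u \<in> A i" "v \<in> A i" by (rule nsets_2_cases)
    then show "e \<in> H" using f doubleton_in_nsets_2[of u V v]
      unfolding A_def proper_colouring_def by fastforce
  qed
  have le3: "card (A i) \<le> 3" for i
  proof (rule ccontr)
    assume "\<not> ?thesis"
    then obtain Q where Q: "Q \<subseteq> A i" "card Q = 4" "finite Q"
      using obtain_subset_with_card_n[of 4 "A i"] by auto
    then have "Q \<in> nsets V 4" unfolding nsets_def A_def by auto
    moreover have "nsets Q 2 \<subseteq> nsets (A i) 2" using Q by (intro nsets_mono)
    ultimately show False using no4[of Q] clique by blast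
  qed
  define T where "T = {i \<in> {..<k}. card (A i) = 3}"
  have disj: "A i \<inter> A j = {}" if "i \<noteq> j" for i j using that unfolding A_def by auto
  have injT: "inj_on A T"
  proof (rule inj_onI)
    fix i j assume ij: "i \<in> T" "j \<in> T" "A i = A j"
    show "i = j" using disj[of i j] ij unfolding T_def by fastforce
  qed
  have "triangle_packing V H (A ` T)"
    unfolding triangle_packing_def
  proof (intro conjI)
    show "A ` T \<subseteq> nsets V 3" unfolding T_def nsets_def using finA by (auto simp: A_def)
    show "disjoint (A ` T)" 
      by (intro pairwiseI) (metis disj disjnt_def imageE)
    show "\<forall>t\<in>A ` T. nsets t 2 \<subseteq> H" using clique by blast
  qed
  then have T: "card T \<le> triangle_packing_number V H"
    using card_le_triangle_packing_number[OF V] card_image[OF injT] by metis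
  have V_eq: "V = (\<Union>i\<in>{..<k}. A i)" using f unfolding A_def proper_colouring_def by auto
  have "card V = (\<Sum>i<k. card (A i))"
    by (subst V_eq, rule card_UN_disjoint) (use finA disj in auto)
  also have "\<dots> \<le> (\<Sum>i<k. 2 + of_bool (card (A i) = 3))"
  proof (rule sum_mono)
    fix i show "card (A i) \<le> 2 + of_bool (card (A i) = 3)" using le3[of i] by auto
  qed
  also have "\<dots> = 2 * k + card T"
    unfolding sum.distrib T_def by (simp add: sum_of_bool_eq Int_def)
  finally show ?thesis using T k_def by linarith
qed

text \<open>
  Use the triangles of the packing, the edges of the matching and at most one singleton as colour
  classes.
\<close>

lemma chromatic_number_le_packing_matching:
  assumes V: "finite V" and H: "H \<subseteq> nsets V 2" and P: "triangle_packing V H P"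
    and M: "matching_in {e \<in> H. e \<subseteq> V - \<Union>P} M" and rest: "card (V - \<Union>P - \<Union>M) \<le> 1"
  shows "2 * chromatic_number V (nsets V 2 - H) + card P \<le> card V + 1"
proof -
  define R where "R = V - \<Union>P - \<Union>M"
  have MH: "M \<subseteq> H" "\<Union>M \<subseteq> V - \<Union>P" using M unfolding matching_in_def by auto
  have finH: "finite H" using H V by (meson finite_imp_finite_nsets finite_subset)
  have finM: "finite M" using MH finH finite_subset by blast
  have PV: "P \<subseteq> nsets V 3" using P unfolding triangle_packing_def by blast
  have finP: "finite P" using PV V by (meson finite_imp_finite_nsets finite_subset)
  have finR: "finite R" unfolding R_def using V by auto
  have two: "\<And>e. e \<in> M \<Longrightarrow> card e = 2" using MH H unfolding nsets_def by auto
  define C where "C = P \<union> M \<union> (\<lambda>x. {x}) ` R"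
  have "chromatic_number V (nsets V 2 - H) \<le> card C"
  proof (rule chromatic_number_le_clique_cover)
    show "finite C" unfolding C_def using finP finM finR by auto
    show "V \<subseteq> \<Union>C" unfolding C_def R_def by auto
    fix c u v assume c: "c \<in> C" "u \<in> c" "v \<in> c" "u \<noteq> v"
    consider "c \<in> P" | "c \<in> M" | x where "c = {x}" using c(1) unfolding C_def by auto
    then show "{u, v} \<in> H"
    proof cases
      case 1
      then show ?thesis using P doubleton_in_nsets_2[of u c v] c unfolding triangle_packing_def by blast
    next
      case 2
      then have "c = {u, v}" using two[OF 2] c by (auto simp: card_2_iff)
      then show ?thesis using 2 MH by auto
    qed (use c in auto)
  qed
  also have "card C \<le> card P + card M + card R"
    unfolding C_def using card_Un_le[of "P \<union> M" "(\<lambda>x. {x}) ` R"] card_Un_le[of P M]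
      card_image_le[OF finR, of "\<lambda>x. {x}"] by linarith
  finally have chi: "chromatic_number V (nsets V 2 - H) \<le> card P + card M + card R" .
  have "card (\<Union>M) = sum card M"
    using M two unfolding matching_in_def
    by (intro card_Union_disjoint) (auto intro: card_ge_0_finite)
  also have "\<dots> = 2 * card M" using two by simp
  finally have cM: "card (\<Union>M) = 2 * card M" .
  have UP: "\<Union>P \<subseteq> V" using PV unfolding nsets_def by auto
  have fin: "finite (\<Union>P)" "finite (\<Union>M)" using UP MH V finite_subset by blast+
  have "card V = card (\<Union>P) + (card (\<Union>M) + card R)"
  proof -
    have "V = \<Union>P \<union> (\<Union>M \<union> R)" using UP MH unfolding R_def by auto
    moreover have "card (\<Union>P \<union> (\<Union>M \<union> R)) = card (\<Union>P) + card (\<Union>M \<union> R)"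
      by (rule card_Un_disjoint) (use fin finR MH in \<open>auto simp: R_def\<close>)
    moreover have "card (\<Union>M \<union> R) = card (\<Union>M) + card R"
      by (rule card_Un_disjoint) (use fin finR in \<open>auto simp: R_def\<close>)
    ultimately show ?thesis by simp
  qed
  then show ?thesis using chi cM rest triangle_packing_card_Union[OF V P] unfolding R_def by linarith
qed

section \<open>Matchings outside a triangle packing\<close>

text \<open>
  A set of disjoint triangles avoiding \<open>x\<close>, each with a marked vertex adjacent to \<open>x\<close>. Large ones are the
  reason why a vertex outside a triangle packing may have many neighbours inside it. Since the triangles
  and the marked edges are all distinct edges of \<open>H\<close>, a given bouquet of size \<open>k\<close> is present
  with probability \<open>q ^ (4 * k)\<close>, and a union bound over bouquets deals with the packing although it
  depends on \<open>H\<close>.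
\<close>

definition bouquet :: "'a set \<Rightarrow> 'a set set \<Rightarrow> 'a \<Rightarrow> ('a set \<times> 'a) set \<Rightarrow> bool" where
  "bouquet V H x K \<longleftrightarrow> K \<subseteq> (SIGMA t:nsets (V - {x}) 3. t) \<and> inj_on fst K \<and> disjoint (fst ` K) \<and>
     (\<forall>(t, y)\<in>K. nsets t 2 \<subseteq> H \<and> {x, y} \<in> H)"

lemma sum_degrees_le:
  assumes Z: "finite Z" and B: "B \<subseteq> Z" and H: "H \<subseteq> nsets V 2"
  shows "(\<Sum>x\<in>B. card {y \<in> Z. {x, y} \<in> H}) \<le> 2 * card (nsets Z 2 \<inter> H)"
proof -
  have finB: "finite B" using B Z finite_subset by blast
  have fin: "finite (nsets Z 2 \<inter> H)" using Z by (simp add: finite_imp_finite_nsets)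
  have "(\<Sum>x\<in>B. card {y \<in> Z. {x, y} \<in> H}) = card (SIGMA x:B. {y \<in> Z. {x, y} \<in> H})"
    using finB Z by simp
  also have "\<dots> \<le> card (\<Union>e\<in>nsets Z 2 \<inter> H. {(x, y). {x, y} = e})"
  proof (rule card_mono)
    have sub: "{(x, y). {x, y} = e} \<subseteq> e \<times> e" for e :: "'a set" by auto
    have "finite {(x, y). {x, y} = e}" if "e \<in> nsets Z 2 \<inter> H" for e
      using that by (intro finite_subset[OF sub]) (auto simp: nsets_def)
    then show "finite (\<Union>e\<in>nsets Z 2 \<inter> H. {(x, y). {x, y} = e})" using fin by blast
    show "(SIGMA x:B. {y \<in> Z. {x, y} \<in> H}) \<subseteq> (\<Union>e\<in>nsets Z 2 \<inter> H. {(x, y). {x, y} = e})"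
    proof
      fix p assume "p \<in> (SIGMA x:B. {y \<in> Z. {x, y} \<in> H})"
      then obtain x y where p: "p = (x, y)" "x \<in> Z" "y \<in> Z" "{x, y} \<in> H" using B by blast
      then have "x \<noteq> y" using H unfolding nsets_def by auto
      then show "p \<in> (\<Union>e\<in>nsets Z 2 \<inter> H. {(x, y). {x, y} = e})"
        using p doubleton_in_nsets_2[of x Z y] by auto
    qed
  qed
  also have "\<dots> \<le> (\<Sum>e\<in>nsets Z 2 \<inter> H. card {(x, y). {x, y} = e})"
    by (rule card_UN_le[OF fin])
  also have "\<dots> \<le> (\<Sum>e\<in>nsets Z 2 \<inter> H. 2)"
  proof (rule sum_mono)
    fix e assume "e \<in> nsets Z 2 \<inter> H"
    then obtain u v where "e = {u, v}" using nsets_2_cases by (metis IntD1)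
    then have "{(x, y). {x, y} = e} \<subseteq> {(u, v), (v, u)}" by (auto simp: doubleton_eq_iff)
    then have "card {(x, y). {x, y} = e} \<le> card {(u, v), (v, u)}" by (intro card_mono) auto
    also have "\<dots> \<le> 2" using card_length[of "[(u, v), (v, u)]"] by simp
    finally show "card {(x, y). {x, y} = e} \<le> 2" .
  qed
  finally show ?thesis by simp
qed

text \<open>
  Keep the triangles of the packing that contain a neighbour of \<open>x\<close> and mark one neighbour in each; a
  triangle holds at most three of them.
\<close>

lemma bouquet_from_packing:
  assumes V: "finite V" and P: "triangle_packing V H P" and x: "x \<notin> \<Union>P"
  shows "\<exists>K. bouquet V H x K \<and> card {y \<in> \<Union>P. {x, y} \<in> H} \<le> 3 * card K"
proof -
  define P' where "P' = {t \<in> P. \<exists>y\<in>t. {x, y} \<in> H}"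
  have PV: "P \<subseteq> nsets V 3" "disjoint P" "\<And>t. t \<in> P \<Longrightarrow> nsets t 2 \<subseteq> H"
    using P unfolding triangle_packing_def by blast+
  have "\<forall>t\<in>P'. \<exists>y. y \<in> t \<and> {x, y} \<in> H" unfolding P'_def by blast
  from bchoice[OF this] obtain f where f: "\<forall>t\<in>P'. f t \<in> t \<and> {x, f t} \<in> H" by blast
  define K where "K = (\<lambda>t. (t, f t)) ` P'"
  have fstK: "fst ` K = P'" unfolding K_def by (simp add: image_image)
  have P'P: "P' \<subseteq> P" unfolding P'_def by auto
  have "bouquet V H x K"
    unfolding bouquet_def
  proof (intro conjI)
    show "K \<subseteq> (SIGMA t:nsets (V - {x}) 3. t)"
    proof
      fix k assume "k \<in> K"
      then obtain t where t: "t \<in> P'" "k = (t, f t)" unfolding K_def by blast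
      then have "t \<in> nsets V 3" "x \<notin> t" using P'P PV x by blast+
      then have "t \<in> nsets (V - {x}) 3" unfolding nsets_def by blast
      then show "k \<in> (SIGMA t:nsets (V - {x}) 3. t)" using t f by blast
    qed
    show "inj_on fst K" unfolding K_def by (auto simp: inj_on_def)
    show "disjoint (fst ` K)" unfolding fstK using PV P'P by (meson pairwise_subset)
    show "\<forall>(t, y)\<in>K. nsets t 2 \<subseteq> H \<and> {x, y} \<in> H"
      using PV P'P f unfolding K_def by blast
  qed
  moreover have "card {y \<in> \<Union>P. {x, y} \<in> H} \<le> 3 * card K"
  proof -
    have "triangle_packing V H P'"
      using P P'P unfolding triangle_packing_def by (meson pairwise_subset subset_trans subsetD)
    then have "card (\<Union>P') = 3 * card P'" using triangle_packing_card_Union[OF V] by blast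
    moreover have "card K = card P'" unfolding K_def by (rule card_image) (simp add: inj_on_def)
    moreover have "\<Union>P' \<subseteq> V" using PV P'P unfolding nsets_def by blast
    then have "finite (\<Union>P')" using V finite_subset by blast
    then have "card {y \<in> \<Union>P. {x, y} \<in> H} \<le> card (\<Union>P')"
      by (rule card_mono) (auto simp: P'_def)
    ultimately show ?thesis by simp
  qed
  ultimately show ?thesis by blast
qed

text \<open>
  Only the expansion of a small set \<open>B\<close> outside the packing needs an argument. Each vertex of \<open>B\<close> keeps
  \<open>d / 8 - 3 * (d / 48) = d / 16\<close> neighbours outside the packing. If there were fewer than \<open>card B\<close> outer
  neighbours, these edges would lie inside a set \<open>Z\<close> of fewer than \<open>2 * card B\<close> vertices, which would be
  denser than sparsity permits.
\<close>

theorem pseudorandom_near_perfect_matching: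
  fixes V :: "'a set" and d :: real
  assumes V: "finite V" and H: "H \<subseteq> nsets V 2" and d: "d > 0" and s: "s \<ge> 1"
    and deg: "\<And>x. x \<in> V \<Longrightarrow> d / 8 < real (card {y \<in> V. {x, y} \<in> H})"
    and sparse: "\<And>Z. Z \<subseteq> V \<Longrightarrow> Z \<noteq> {} \<Longrightarrow> card Z < 6 * s \<Longrightarrow>
                  real (card (nsets Z 2 \<inter> H)) < d / 64 * real (card Z)"
    and edge: "\<And>A B. A \<subseteq> V \<Longrightarrow> B \<subseteq> V \<Longrightarrow> A \<inter> B = {} \<Longrightarrow> card A = s \<Longrightarrow> card B = s \<Longrightarrow>
                  \<exists>x\<in>A. \<exists>y\<in>B. {x, y} \<in> H"
    and few: "\<And>x K. x \<in> V \<Longrightarrow> bouquet V H x K \<Longrightarrow> real (card K) < d / 48"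
    and P: "triangle_packing V H P"
  shows "\<exists>M. matching_in {e \<in> H. e \<subseteq> V - \<Union>P} M \<and> card (V - \<Union>P - \<Union>M) \<le> 1"
proof (rule expanding_graph_near_perfect_matching[where s = s])
  let ?X = "V - \<Union>P" and ?G = "{e \<in> H. e \<subseteq> V - \<Union>P}"
  show "finite ?X" using V by simp
  show "card e = 2" if "e \<in> ?G" for e using that H unfolding nsets_def by auto
  show "e \<subseteq> ?X" if "e \<in> ?G" for e using that by simp
  show "s \<ge> 1" by (rule s)
  show "\<exists>x\<in>A. \<exists>y\<in>B. {x, y} \<in> ?G"
    if AB: "A \<subseteq> ?X" "B \<subseteq> ?X" "A \<inter> B = {}" "s \<le> card A" "s \<le> card B" for A B
  proof -
    obtain A' where A': "A' \<subseteq> A" "card A' = s" using obtain_subset_with_card_n[OF AB(4)] by metis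
    obtain B' where B': "B' \<subseteq> B" "card B' = s" using obtain_subset_with_card_n[OF AB(5)] by metis
    have "\<exists>x\<in>A'. \<exists>y\<in>B'. {x, y} \<in> H" by (rule edge) (use A' B' AB in auto)
    then show ?thesis using A' B' AB by blast
  qed
  fix B assume B: "B \<subseteq> ?X" "B \<noteq> {}" "card B < 3 * s"
  define N where "N = {y. \<exists>x\<in>B. {x, y} \<in> ?G} - B"
  define Z where "Z = B \<union> N"
  have NX: "N \<subseteq> ?X" unfolding N_def by auto
  then have ZX: "Z \<subseteq> ?X" using B Z_def by blast
  have finZ: "finite Z" using ZX V by (meson finite_Diff finite_subset)
  have finB: "finite B" using finZ Z_def by simp
  show "card B \<le> card ({y. \<exists>x\<in>B. {x, y} \<in> ?G} - B)"
  proof (rule ccontr)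
    assume "\<not> ?thesis"
    then have "card N < card B" unfolding N_def by simp
    then have cZ: "card Z < 2 * card B" unfolding Z_def using card_Un_le[of B N] by linarith
    have inner: "d / 16 \<le> real (card {y \<in> Z. {x, y} \<in> H})" if x: "x \<in> B" for x
    proof -
      have xP: "x \<notin> \<Union>P" "x \<in> V" using x B by blast+
      obtain K where K: "bouquet V H x K" "card {y \<in> \<Union>P. {x, y} \<in> H} \<le> 3 * card K"
        using bouquet_from_packing[OF V P xP(1)] by blast
      have "real (card {y \<in> \<Union>P. {x, y} \<in> H}) \<le> d / 16" using few[OF xP(2) K(1)] K(2) by linarith
      moreover have "{y \<in> V. {x, y} \<in> H} \<subseteq> {y \<in> \<Union>P. {x, y} \<in> H} \<union> {y \<in> Z. {x, y} \<in> H}"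
      proof
        fix y assume y: "y \<in> {y \<in> V. {x, y} \<in> H}"
        show "y \<in> {y \<in> \<Union>P. {x, y} \<in> H} \<union> {y \<in> Z. {x, y} \<in> H}"
        proof (cases "y \<in> \<Union>P")
          case False
          then have "{x, y} \<in> ?G" using x y xP by simp
          then have "y \<in> Z" using x unfolding Z_def N_def by blast
          then show ?thesis using y by simp
        qed (use y in simp)
      qed
      then have "card {y \<in> V. {x, y} \<in> H} \<le> card ({y \<in> \<Union>P. {x, y} \<in> H} \<union> {y \<in> Z. {x, y} \<in> H})"
        using V P finZ unfolding triangle_packing_def nsets_def
        by (intro card_mono) (auto intro: finite_subset[OF _ V])
      then have "card {y \<in> V. {x, y} \<in> H} \<le> card {y \<in> \<Union>P. {x, y} \<in> H} + card {y \<in> Z. {x, y} \<in> H}"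
        using card_Un_le order_trans by blast
      ultimately show ?thesis using deg[OF xP(2)] by linarith
    qed
    have "real (card B) * (d / 16) \<le> (\<Sum>x\<in>B. real (card {y \<in> Z. {x, y} \<in> H}))"
      using sum_mono[of B "\<lambda>_. d / 16", OF inner] by simp
    also have "\<dots> \<le> real (2 * card (nsets Z 2 \<inter> H))"
      using sum_degrees_le[OF finZ _ H, of B] unfolding Z_def of_nat_sum[symmetric] by (simp only: of_nat_le_iff) simp
    also have "\<dots> < 2 * (d / 64 * real (card Z))"
    proof -
      have "Z \<subseteq> V" "Z \<noteq> {}" "card Z < 6 * s" using ZX B cZ unfolding Z_def by auto
      from sparse[OF this] show ?thesis by simp
    qed
    also have "\<dots> \<le> 2 * (d / 64 * (2 * real (card B)))"
      using cZ d by (intro mult_left_mono) auto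
    finally show False by (simp add: field_simps)
  qed
qed

section \<open>First moment estimates for random graphs\<close>

lemma neighbours_eq_edge_count:
  assumes "x \<in> V" "H \<subseteq> nsets V 2"
  shows "card {y \<in> V. {x, y} \<in> H} = card ((\<lambda>y. {x, y}) ` (V - {x}) \<inter> H)"
proof -
  have "(\<lambda>y. {x, y}) ` (V - {x}) \<inter> H = (\<lambda>y. {x, y}) ` {y \<in> V. {x, y} \<in> H}"
    using assms by (auto simp: nsets_def)
  moreover have "inj_on (\<lambda>y. {x, y}) {y \<in> V. {x, y} \<in> H}"
    by (auto simp: inj_on_def doubleton_eq_iff)
  ultimately show ?thesis by (simp add: card_image)
qed

lemma prob_low_degree:
  assumes V: "finite V" and q: "0 \<le> q" "q \<le> 1"
  shows "subset_prob q (nsets V 2) (\<lambda>H. \<exists>x\<in>V. real (card {y \<in> V. {x, y} \<in> H}) \<le> t)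
    \<le> real (card V) * exp (t - q * (real (card V) - 1) / 2)"
proof -
  let ?F = "\<lambda>x. (\<lambda>y. {x, y}) ` (V - {x})"
  have U: "finite (nsets V 2)" using V by (rule finite_imp_finite_nsets)
  have "subset_prob q (nsets V 2) (\<lambda>H. \<exists>x\<in>V. real (card {y \<in> V. {x, y} \<in> H}) \<le> t)
     \<le> (\<Sum>x\<in>V. subset_prob q (nsets V 2) (\<lambda>H. real (card {y \<in> V. {x, y} \<in> H}) \<le> t))"
    by (rule subset_prob_union_bound[OF V q])
  also have "\<dots> \<le> (\<Sum>x\<in>V. exp (t - q * (real (card V) - 1) / 2))"
  proof (rule sum_mono)
    fix x assume x: "x \<in> V"
    have cF: "real (card (?F x)) = real (card V) - 1"
    proof -
      have "card (?F x) = card (V - {x})" by (rule card_image) (auto simp: inj_on_def doubleton_eq_iff)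
      moreover have "card V > 0" using x V card_gt_0_iff by blast
      ultimately show ?thesis using x V by (simp add: of_nat_diff)
    qed
    have "subset_prob q (nsets V 2) (\<lambda>H. real (card {y \<in> V. {x, y} \<in> H}) \<le> t)
       = subset_prob q (nsets V 2) (\<lambda>H. real (card (?F x \<inter> H)) \<le> t)"
      by (rule subset_expectation_cong) (simp add: neighbours_eq_edge_count[OF x])
    also have "\<dots> \<le> exp (t - q * real (card (?F x)) / 2)"
      using x doubleton_in_nsets_2[of x V] by (intro subset_prob_lower_tail[OF U _ q]) auto
    finally show "subset_prob q (nsets V 2) (\<lambda>H. real (card {y \<in> V. {x, y} \<in> H}) \<le> t)
       \<le> exp (t - q * (real (card V) - 1) / 2)" unfolding cF .
  qed
  finally show ?thesis by simp
qed

lemma choose_le_power: "real (m choose k) \<le> real m ^ k"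
proof -
  have "m choose k \<le> m ^ k"
    by (cases "k \<le> m") (simp_all add: binomial_le_pow binomial_eq_0)
  then have "real (m choose k) \<le> real (m ^ k)" by (simp only: of_nat_le_iff)
  then show ?thesis by simp
qed

lemma choose_2_le: "2 * real (m choose 2) \<le> (real m)\<^sup>2"
proof -
  have "(m choose 2) * 2 \<le> m ^ 2" using binomial_fact_pow[of m 2] by (simp add: eval_nat_numeral)
  then have "real ((m choose 2) * 2) \<le> real (m ^ 2)" by (simp only: of_nat_le_iff)
  then show ?thesis by simp
qed

lemma sum_Pow_power_card:
  fixes r :: real
  assumes "finite V"
  shows "(\<Sum>Z\<in>Pow V. r ^ card Z) = (1 + r) ^ card V"
  using prod_add[OF assms, of "\<lambda>_. r" "\<lambda>_. 1"] by (simp add: add.commute)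

text \<open>
  Vertex sets of size \<open>z\<close> contribute at most \<open>exp (- t * z / 2)\<close> each, and the sum over all nonempty sets
  is a binomial expansion.
\<close>

lemma prob_dense_spot:
  assumes V: "finite V" and q: "0 \<le> q" "q \<le> 1"
    and m: "\<And>Z. Z \<subseteq> V \<Longrightarrow> card Z < m \<Longrightarrow> q * real (card Z) \<le> t / 2" and t: "0 \<le> t"
  shows "subset_prob q (nsets V 2)
      (\<lambda>H. \<exists>Z\<in>{Z. Z \<subseteq> V \<and> Z \<noteq> {} \<and> card Z < m}. t * real (card Z) \<le> real (card (nsets Z 2 \<inter> H)))
    \<le> exp (real (card V) * exp (- t / 2)) - 1"
proof -
  let ?I = "{Z. Z \<subseteq> V \<and> Z \<noteq> {} \<and> card Z < m}"
  have U: "finite (nsets V 2)" using V by (rule finite_imp_finite_nsets)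
  have I: "finite ?I" using V by simp
  have "subset_prob q (nsets V 2) (\<lambda>H. \<exists>Z\<in>?I. t * real (card Z) \<le> real (card (nsets Z 2 \<inter> H)))
     \<le> (\<Sum>Z\<in>?I. subset_prob q (nsets V 2) (\<lambda>H. t * real (card Z) \<le> real (card (nsets Z 2 \<inter> H))))"
    by (rule subset_prob_union_bound[OF I q])
  also have "\<dots> \<le> (\<Sum>Z\<in>?I. exp (- t / 2) ^ card Z)"
  proof (rule sum_mono)
    fix Z assume Z: "Z \<in> ?I"
    have sub: "nsets Z 2 \<subseteq> nsets V 2" using Z by (intro nsets_mono) auto
    have "subset_prob q (nsets V 2) (\<lambda>H. t * real (card Z) \<le> real (card (nsets Z 2 \<inter> H)))
       \<le> exp (2 * q * real (card (nsets Z 2)) - t * real (card Z))"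
      by (rule subset_prob_upper_tail[OF U sub q])
    also have "\<dots> \<le> exp (- t / 2 * real (card Z))"
    proof -
      have "2 * q * real (card (nsets Z 2)) \<le> q * (real (card Z))\<^sup>2"
        using mult_left_mono[OF choose_2_le[of "card Z"] q(1)] by (simp add: mult_ac)
      also have "\<dots> = (q * real (card Z)) * real (card Z)" by (simp add: power2_eq_square)
      also have "\<dots> \<le> t / 2 * real (card Z)"
        using m Z by (intro mult_right_mono) auto
      finally show ?thesis by (simp add: field_simps)
    qed
    also have "\<dots> = exp (- t / 2) ^ card Z" by (simp add: exp_of_nat_mult[symmetric] mult.commute)
    finally show "subset_prob q (nsets V 2) (\<lambda>H. t * real (card Z) \<le> real (card (nsets Z 2 \<inter> H)))
       \<le> exp (- t / 2) ^ card Z" .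
  qed
  also have "\<dots> \<le> (\<Sum>Z\<in>Pow V - {{}}. exp (- t / 2) ^ card Z)"
    using V by (intro sum_mono2) auto
  also have "\<dots> = (1 + exp (- t / 2)) ^ card V - 1"
    using V sum_Pow_power_card[OF V, of "exp (- t / 2)"] by (simp add: sum_diff1)
  also have "\<dots> \<le> exp (real (card V) * exp (- t / 2)) - 1"
    using one_plus_power_le_exp[of "exp (- t / 2)" "card V"] by (simp add: order_trans[OF _ exp_ge_zero])
  finally show ?thesis .
qed

text \<open>
  There are at most \<open>4 ^ card V\<close> pairs of sets.
\<close>

lemma prob_hole:
  assumes V: "finite V" and q: "0 \<le> q" "q \<le> 1"
  shows "subset_prob q (nsets V 2)
      (\<lambda>H. \<exists>(A, B)\<in>{(A, B). A \<subseteq> V \<and> B \<subseteq> V \<and> A \<inter> B = {} \<and> card A = s \<and> card B = s}.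
         \<forall>x\<in>A. \<forall>y\<in>B. {x, y} \<notin> H)
    \<le> 4 ^ card V * exp (- q * (real s)\<^sup>2 / 2)"
proof -
  let ?I = "{(A, B). A \<subseteq> V \<and> B \<subseteq> V \<and> A \<inter> B = {} \<and> card A = s \<and> card B = s}"
  have sub: "?I \<subseteq> Pow V \<times> Pow V" by auto
  have I: "finite ?I" using V by (intro finite_subset[OF sub]) auto
  have "card ?I \<le> card (Pow V \<times> Pow V)" using V by (intro card_mono[OF _ sub]) auto
  also have "\<dots> = 4 ^ card V"
    using V by (simp add: card_cartesian_product card_Pow flip: power_mult_distrib)
  finally have cI: "card ?I \<le> 4 ^ card V" .
  have U: "finite (nsets V 2)" using V by (rule finite_imp_finite_nsets)
  have "subset_prob q (nsets V 2) (\<lambda>H. \<exists>(A, B)\<in>?I. \<forall>x\<in>A. \<forall>y\<in>B. {x, y} \<notin> H)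
     \<le> (\<Sum>p\<in>?I. subset_prob q (nsets V 2) (\<lambda>H. case p of (A, B) \<Rightarrow> \<forall>x\<in>A. \<forall>y\<in>B. {x, y} \<notin> H))"
    by (rule subset_prob_union_bound[OF I q])
  also have "\<dots> \<le> (\<Sum>p\<in>?I. exp (- q * (real s)\<^sup>2 / 2))"
  proof (rule sum_mono)
    fix p assume "p \<in> ?I"
    then obtain A B where p: "p = (A, B)" and AB: "A \<subseteq> V" "B \<subseteq> V" "A \<inter> B = {}" "card A = s" "card B = s"
      by auto
    let ?F = "(\<lambda>(x, y). {x, y}) ` (A \<times> B)"
    have FU: "?F \<subseteq> nsets V 2"
    proof
      fix e assume "e \<in> ?F"
      then obtain x y where e: "e = {x, y}" "x \<in> A" "y \<in> B" by auto
      then have "x \<noteq> y" using AB by blast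
      then show "e \<in> nsets V 2" using e AB doubleton_in_nsets_2[of x V y] by blast
    qed
    have "inj_on (\<lambda>(x, y). {x, y}) (A \<times> B)"
      using AB by (auto simp: inj_on_def doubleton_eq_iff)
    then have cF: "card ?F = s\<^sup>2"
      using AB by (simp add: card_image card_cartesian_product power2_eq_square)
    have finF: "finite ?F" using FU U finite_subset by blast
    have "subset_prob q (nsets V 2) (\<lambda>H. case p of (A, B) \<Rightarrow> \<forall>x\<in>A. \<forall>y\<in>B. {x, y} \<notin> H)
        \<le> subset_prob q (nsets V 2) (\<lambda>H. real (card (?F \<inter> H)) \<le> 0)"
    proof (rule subset_expectation_mono[OF q])
      fix H :: "'a set set"
      have "?F \<inter> H = {}" if "\<forall>x\<in>A. \<forall>y\<in>B. {x, y} \<notin> H" using that by auto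
      then show "of_bool (case p of (A, B) \<Rightarrow> \<forall>x\<in>A. \<forall>y\<in>B. {x, y} \<notin> H) \<le> (of_bool (real (card (?F \<inter> H)) \<le> 0) :: real)"
        unfolding p by (cases "\<forall>x\<in>A. \<forall>y\<in>B. {x, y} \<notin> H") auto
    qed
    also have "\<dots> \<le> exp (0 - q * real (card ?F) / 2)"
      by (rule subset_prob_lower_tail[OF U FU q])
    finally show "subset_prob q (nsets V 2) (\<lambda>H. case p of (A, B) \<Rightarrow> \<forall>x\<in>A. \<forall>y\<in>B. {x, y} \<notin> H)
        \<le> exp (- q * (real s)\<^sup>2 / 2)" unfolding cF by simp
  qed
  also have "\<dots> = real (card ?I) * exp (- q * (real s)\<^sup>2 / 2)" by simp
  also have "\<dots> \<le> 4 ^ card V * exp (- q * (real s)\<^sup>2 / 2)"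
  proof (rule mult_right_mono)
    have "real (card ?I) \<le> real (4 ^ card V)" using cI by (simp only: of_nat_le_iff)
    then show "real (card ?I) \<le> 4 ^ card V" by simp
  qed simp
  finally show ?thesis .
qed

lemma prob_K4:
  assumes V: "finite V" and q: "0 \<le> q" "q \<le> 1"
  shows "subset_prob q (nsets V 2) (\<lambda>H. \<exists>Q\<in>nsets V 4. nsets Q 2 \<subseteq> H) \<le> real (card V) ^ 4 * q ^ 6"
proof -
  have U: "finite (nsets V 2)" using V by (rule finite_imp_finite_nsets)
  have "subset_prob q (nsets V 2) (\<lambda>H. \<exists>Q\<in>nsets V 4. nsets Q 2 \<subseteq> H)
     \<le> (\<Sum>Q\<in>nsets V 4. subset_prob q (nsets V 2) (\<lambda>H. nsets Q 2 \<subseteq> H))"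
    by (rule subset_prob_union_bound[OF finite_imp_finite_nsets[OF V] q])
  also have "\<dots> = (\<Sum>Q\<in>nsets V 4. q ^ 6)"
  proof (rule sum.cong[OF refl])
    fix Q assume Q: "Q \<in> nsets V 4"
    have "nsets Q 2 \<subseteq> nsets V 2" using Q by (intro nsets_mono) (auto simp: nsets_def)
    moreover have "card Q = 4" using Q unfolding nsets_def by simp
    then have "card (nsets Q 2) = 6" by (simp add: choose_two)
    ultimately show "subset_prob q (nsets V 2) (\<lambda>H. nsets Q 2 \<subseteq> H) = q ^ 6"
      by (simp add: subset_prob_superset[OF U])
  qed
  also have "\<dots> \<le> real (card V) ^ 4 * q ^ 6"
    using q choose_le_power[of "card V" 4] by (simp add: mult_right_mono)
  finally show ?thesis .
qed

lemma expectation_triangle_packing_number: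
  assumes V: "finite V" and q: "0 \<le> q" "q \<le> 1"
  shows "subset_expectation q (nsets V 2) (\<lambda>H. real (triangle_packing_number V H)) \<le> real (card V) ^ 3 * q ^ 3"
proof -
  have U: "finite (nsets V 2)" using V by (rule finite_imp_finite_nsets)
  have T: "finite (nsets V 3)" using V by (rule finite_imp_finite_nsets)
  have "subset_expectation q (nsets V 2) (\<lambda>H. real (triangle_packing_number V H))
     \<le> subset_expectation q (nsets V 2) (\<lambda>H. \<Sum>t\<in>nsets V 3. of_bool (nsets t 2 \<subseteq> H))"
  proof (rule subset_expectation_mono[OF q])
    fix H :: "'a set set"
    obtain P where P: "triangle_packing V H P" "card P = triangle_packing_number V H"
      using obtain_maximum_triangle_packing[OF V] by blast
    have "card P \<le> card {t \<in> nsets V 3. nsets t 2 \<subseteq> H}"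
      using P T unfolding triangle_packing_def by (intro card_mono) auto
    then show "real (triangle_packing_number V H) \<le> (\<Sum>t\<in>nsets V 3. of_bool (nsets t 2 \<subseteq> H))"
      using P T by (simp add: sum_of_bool_eq Int_def)
  qed
  also have "\<dots> = (\<Sum>t\<in>nsets V 3. subset_prob q (nsets V 2) (\<lambda>H. nsets t 2 \<subseteq> H))"
    by (rule subset_expectation_sum)
  also have "\<dots> = (\<Sum>t\<in>nsets V 3. q ^ 3)"
  proof (rule sum.cong[OF refl])
    fix t assume t: "t \<in> nsets V 3"
    have "nsets t 2 \<subseteq> nsets V 2" using t by (intro nsets_mono) (auto simp: nsets_def)
    moreover have "card t = 3" using t unfolding nsets_def by simp
    then have "card (nsets t 2) = 3" by (simp add: choose_two)
    ultimately show "subset_prob q (nsets V 2) (\<lambda>H. nsets t 2 \<subseteq> H) = q ^ 3"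
      by (simp add: subset_prob_superset[OF U])
  qed
  also have "\<dots> \<le> real (card V) ^ 3 * q ^ 3"
    using q choose_le_power[of "card V" 3] by (simp add: mult_right_mono)
  finally show ?thesis .
qed

text \<open>
  A union bound over the centre and over the bouquets of size exactly \<open>k = \<lceil>t\<rceil>\<close>, each of which consists
  of \<open>4 * k\<close> edges; the number of choices for a triangle with a marked vertex is at most
  \<open>3 * card V ^ 3\<close>.
\<close>

lemma prob_large_bouquet:
  assumes V: "finite V" and q: "0 \<le> q" "q \<le> 1" and t: "0 \<le> t"
  shows "subset_prob q (nsets V 2) (\<lambda>H. \<exists>x\<in>V. \<exists>K. bouquet V H x K \<and> t \<le> real (card K))
    \<le> real (card V) * exp (9 * real (card V) ^ 3 * q ^ 4 - t)"
proof -
  define k where "k = nat \<lceil>t\<rceil>"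
  have k: "t \<le> real k" "\<And>m. t \<le> real m \<Longrightarrow> k \<le> m" unfolding k_def using t by linarith+
  have U: "finite (nsets V 2)" using V by (rule finite_imp_finite_nsets)
  define S where "S x = (SIGMA t:nsets (V - {x}) 3. t)" for x
  define J where "J x = {K. K \<subseteq> S x \<and> card K = k \<and> inj_on fst K \<and> disjoint (fst ` K)}" for x
  have finS: "finite (S x)" for x
    unfolding S_def using V by (intro finite_SigmaI) (auto simp: nsets_def intro: finite_subset[of _ "Pow V"])
  have finJ: "finite (J x)" for x
    by (rule finite_subset[of _ "Pow (S x)"]) (use finS in \<open>auto simp only: J_def finite_Pow_iff\<close>)
  have cS: "real (card (S x)) \<le> 3 * real (card V) ^ 3" if "x \<in> V" for x
  proof -
    have "card (S x) = (\<Sum>t\<in>nsets (V - {x}) 3. card t)"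
      unfolding S_def using V
      by (intro card_SigmaI) (auto simp: nsets_def intro: finite_subset[of _ "Pow V"])
    also have "\<dots> = (\<Sum>t\<in>nsets (V - {x}) 3. 3)" by (intro sum.cong) (auto simp: nsets_def)
    also have "\<dots> = 3 * (card (V - {x}) choose 3)" by simp
    finally have "real (card (S x)) \<le> 3 * real (card (V - {x})) ^ 3"
      using choose_le_power[of "card (V - {x})" 3] by simp
    also have "\<dots> \<le> 3 * real (card V) ^ 3"
      using V by (intro mult_left_mono power_mono) (auto intro: card_mono)
    finally show ?thesis .
  qed
  have single: "subset_prob q (nsets V 2) (\<lambda>H. bouquet V H x K) \<le> (q ^ 4) ^ k"
    if x: "x \<in> V" and K: "K \<in> J x" for x K
  proof -
    define F where "F p = insert {x, snd p} (nsets (fst p) 2)" for p :: "'a set \<times> 'a"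
    have p: "fst p \<subseteq> V - {x}" "finite (fst p)" "card (fst p) = 3" "snd p \<in> fst p" if "p \<in> K" for p
    proof -
      obtain a b where ab: "p = (a, b)" by fastforce
      have "p \<in> S x" using that K unfolding J_def by blast
      then show "fst p \<subseteq> V - {x}" "finite (fst p)" "card (fst p) = 3" "snd p \<in> fst p"
        unfolding ab S_def nsets_def by auto
    qed
    have finK: "finite K" using K finS finite_subset unfolding J_def by blast
    have cF: "card (F p) = 4" "finite (F p)" if "p \<in> K" for p
    proof -
      have "{x, snd p} \<notin> nsets (fst p) 2" using p[OF that] unfolding nsets_def by auto
      moreover have "card (nsets (fst p) 2) = 3" using p[OF that] by (simp add: choose_two)
      moreover have "finite (nsets (fst p) 2)" using p[OF that] by (simp add: finite_imp_finite_nsets)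
      ultimately show "card (F p) = 4" "finite (F p)" unfolding F_def by simp_all
    qed
    have disj: "F p \<inter> F p' = {}" if pp: "p \<in> K" "p' \<in> K" "p \<noteq> p'" for p p'
    proof -
      have "fst p \<noteq> fst p'" using pp K unfolding J_def inj_on_def by blast
      moreover have "disjoint (fst ` K)" using K unfolding J_def by blast
      ultimately have dj: "fst p \<inter> fst p' = {}" using pp unfolding pairwise_def disjnt_def by blast
      have meet: "e \<inter> fst p \<noteq> {} \<and> e \<subseteq> insert x (fst p)" if "p \<in> K" "e \<in> F p" for e p
        using that p[OF that(1)] unfolding F_def nsets_def by (auto simp: card_2_iff)
      show ?thesis
      proof (rule ccontr)
        assume "F p \<inter> F p' \<noteq> {}"
        then obtain e where e: "e \<in> F p" "e \<in> F p'" by blast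
        obtain z where z: "z \<in> e" "z \<in> fst p" using meet[OF pp(1) e(1)] by blast
        have "z \<noteq> x" using p(1)[OF pp(1)] z(2) by blast
        then show False using meet[OF pp(2) e(2)] z dj by blast
      qed
    qed
    have FU: "(\<Union>p\<in>K. F p) \<subseteq> nsets V 2"
    proof
      fix e assume "e \<in> (\<Union>p\<in>K. F p)"
      then obtain p0 where p0: "p0 \<in> K" "e \<in> F p0" by blast
      show "e \<in> nsets V 2"
      proof (cases "e = {x, snd p0}")
        case True
        then show ?thesis using p[OF p0(1)] x doubleton_in_nsets_2[of x V "snd p0"] by blast
      next
        case False
        then have "e \<in> nsets (fst p0) 2" using p0 unfolding F_def by blast
        then show ?thesis using p[OF p0(1)] unfolding nsets_def by blast
      qed
    qed
    have "card (\<Union>p\<in>K. F p) = (\<Sum>p\<in>K. card (F p))"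
      by (rule card_UN_disjoint) (use finK cF disj in auto)
    then have card: "card (\<Union>p\<in>K. F p) = 4 * k" using cF K unfolding J_def by simp
    have "subset_prob q (nsets V 2) (\<lambda>H. bouquet V H x K)
        \<le> subset_prob q (nsets V 2) (\<lambda>H. (\<Union>p\<in>K. F p) \<subseteq> H)"
    proof (rule subset_expectation_mono[OF q])
      fix H :: "'a set set"
      have "(\<Union>p\<in>K. F p) \<subseteq> H" if "bouquet V H x K"
        using that unfolding bouquet_def F_def by fastforce
      then show "of_bool (bouquet V H x K) \<le> (of_bool ((\<Union>p\<in>K. F p) \<subseteq> H) :: real)" by simp
    qed
    also have "\<dots> = (q ^ 4) ^ k"
      unfolding subset_prob_superset[OF U FU] card by (simp add: power_mult)
    finally show ?thesis .
  qed
  have "subset_prob q (nsets V 2) (\<lambda>H. \<exists>x\<in>V. \<exists>K. bouquet V H x K \<and> t \<le> real (card K))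
     \<le> (\<Sum>x\<in>V. subset_prob q (nsets V 2) (\<lambda>H. \<exists>K. bouquet V H x K \<and> t \<le> real (card K)))"
    by (rule subset_prob_union_bound[OF V q])
  also have "\<dots> \<le> (\<Sum>x\<in>V. exp (9 * real (card V) ^ 3 * q ^ 4 - t))"
  proof (rule sum_mono)
    fix x assume x: "x \<in> V"
    have "subset_prob q (nsets V 2) (\<lambda>H. \<exists>K. bouquet V H x K \<and> t \<le> real (card K))
        \<le> subset_prob q (nsets V 2) (\<lambda>H. \<exists>K\<in>J x. bouquet V H x K)"
    proof (rule subset_expectation_mono[OF q])
      fix H :: "'a set set"
      have "\<exists>K\<in>J x. bouquet V H x K" if K: "bouquet V H x K" "t \<le> real (card K)" for K
      proof -
        obtain K' where K': "K' \<subseteq> K" "card K' = k"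
          using obtain_subset_with_card_n[OF k(2)[OF K(2)]] by metis
        have "bouquet V H x K'"
          unfolding bouquet_def
        proof (intro conjI)
          show "K' \<subseteq> (SIGMA t:nsets (V - {x}) 3. t)" using K K' unfolding bouquet_def by blast
          show "inj_on fst K'" using K K' inj_on_subset unfolding bouquet_def by blast
          show "disjoint (fst ` K')"
            using K K' unfolding bouquet_def by (meson image_mono pairwise_subset)
          show "\<forall>(t, y)\<in>K'. nsets t 2 \<subseteq> H \<and> {x, y} \<in> H" using K K' unfolding bouquet_def by blast
        qed
        moreover from this have "K' \<in> J x" using K' unfolding J_def S_def bouquet_def by blast
        ultimately show ?thesis by blast
      qed
      then show "of_bool (\<exists>K. bouquet V H x K \<and> t \<le> real (card K)) \<le> (of_bool (\<exists>K\<in>J x. bouquet V H x K) :: real)"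
        by auto
    qed
    also have "\<dots> \<le> (\<Sum>K\<in>J x. subset_prob q (nsets V 2) (\<lambda>H. bouquet V H x K))"
      by (rule subset_prob_union_bound[OF finJ q])
    also have "\<dots> \<le> (\<Sum>K\<in>J x. (q ^ 4) ^ k)" by (rule sum_mono) (rule single[OF x])
    also have "\<dots> \<le> real (card (S x) choose k) * (q ^ 4) ^ k"
    proof -
      have "card (J x) \<le> card {K. K \<subseteq> S x \<and> card K = k}"
      proof (rule card_mono)
        have "{K. K \<subseteq> S x \<and> card K = k} \<subseteq> Pow (S x)" by blast
        then show "finite {K. K \<subseteq> S x \<and> card K = k}" using finS finite_subset by blast
        show "J x \<subseteq> {K. K \<subseteq> S x \<and> card K = k}" unfolding J_def by blast
      qed
      also have "\<dots> = card (S x) choose k" by (rule n_subsets[OF finS])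
      finally show ?thesis using q by (simp add: mult_right_mono)
    qed
    also have "\<dots> \<le> exp (3 * real (card (S x)) * q ^ 4 - real k)"
      by (rule binomial_power_le_exp) (use q in simp)
    also have "\<dots> \<le> exp (9 * real (card V) ^ 3 * q ^ 4 - t)"
      using mult_right_mono[OF cS[OF x], of "q ^ 4"] q k(1) by simp
    finally show "subset_prob q (nsets V 2) (\<lambda>H. \<exists>K. bouquet V H x K \<and> t \<le> real (card K))
       \<le> exp (9 * real (card V) ^ 3 * q ^ 4 - t)" .
  qed
  finally show ?thesis by simp
qed

section \<open>Planting a random triangle\<close>

text \<open>
  Two triples share three pairs if they coincide, one pair if they have two common vertices, which
  happens for at most \<open>3 * card V\<close> triples \<open>t'\<close>, and none otherwise.
\<close>

lemma triangle_overlap_second_moment: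
  assumes V: "finite V" and q: "0 < q" "q \<le> 1"
  shows "(\<Sum>t\<in>nsets V 3. \<Sum>t'\<in>nsets V 3. (1 / q) ^ card (nsets t 2 \<inter> nsets t' 2))
    \<le> real (card V choose 3) * (real (card V choose 3) + (1 / q) ^ 3 + 3 * real (card V) * (1 / q))"
proof -
  let ?T = "nsets V 3"
  have T: "finite ?T" using V by (rule finite_imp_finite_nsets)
  have "(\<Sum>t\<in>?T. \<Sum>t'\<in>?T. (1 / q) ^ card (nsets t 2 \<inter> nsets t' 2))
    \<le> (\<Sum>t\<in>?T. real (card V choose 3) + (1 / q) ^ 3 + 3 * real (card V) * (1 / q))"
  proof (rule sum_mono)
    fix t assume t: "t \<in> ?T"
    have tV: "t \<subseteq> V" "finite t" "card t = 3" using t unfolding nsets_def by auto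
    define A where "A = {t' \<in> ?T. card (t \<inter> t') = 2}"
    have "(\<Sum>t'\<in>?T. (1 / q) ^ card (nsets t 2 \<inter> nsets t' 2))
      \<le> (\<Sum>t'\<in>?T. (1 + of_bool (t' = t) * (1 / q) ^ 3) + of_bool (t' \<in> A) * (1 / q))"
    proof (rule sum_mono)
      fix t' assume t': "t' \<in> ?T"
      have t'V: "finite t'" "card t' = 3" using t' unfolding nsets_def by auto
      have "nsets t 2 \<inter> nsets t' 2 = nsets (t \<inter> t') 2" unfolding nsets_def by auto
      then have c: "card (nsets t 2 \<inter> nsets t' 2) = card (t \<inter> t') choose 2" by simp
      have "card (t \<inter> t') \<le> 3" using card_mono[of t "t \<inter> t'"] tV by auto
      then consider "card (t \<inter> t') = 0 \<or> card (t \<inter> t') = 1" | "card (t \<inter> t') = 2" | "card (t \<inter> t') = 3"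
        by linarith
      then show "(1 / q) ^ card (nsets t 2 \<inter> nsets t' 2)
         \<le> (1 + of_bool (t' = t) * (1 / q) ^ 3) + of_bool (t' \<in> A) * (1 / q)"
      proof cases
        case 1
        then have z: "card (t \<inter> t') choose 2 = 0" by auto
        show ?thesis unfolding c z using q by simp
      next
        case 2
        then have "t' \<in> A" using t' unfolding A_def by blast
        moreover have z: "card (t \<inter> t') choose 2 = 1" unfolding 2 by (simp add: choose_two)
        ultimately show ?thesis unfolding c z using q by simp
      next
        case 3
        then have "t \<inter> t' = t" "t \<inter> t' = t'"
          using tV t'V by (metis card_subset_eq inf_le1, metis card_subset_eq inf_le2)
        then have "t' = t" by blast
        moreover have z: "card (t \<inter> t') choose 2 = 3" unfolding 3 by (simp add: choose_two)
        ultimately show ?thesis unfolding c z using q by simp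
      qed
    qed
    also have "\<dots> = real (card V choose 3) + (1 / q) ^ 3 + real (card A) * (1 / q)"
    proof -
      have "(\<Sum>t'\<in>?T. of_bool (t' \<in> A) * (1 / q)) = real (card A) * (1 / q)"
        unfolding sum_distrib_right[symmetric] using T
        by (simp add: sum_of_bool_eq A_def Int_def conj_commute)
      moreover have "(\<Sum>t'\<in>?T. of_bool (t' = t) * (1 / q) ^ 3) = (1 / q) ^ 3"
      proof -
        have "(\<Sum>t'\<in>?T. of_bool (t' = t) * (1 / q) ^ 3) = (\<Sum>t'\<in>?T. if t' = t then (1 / q) ^ 3 else 0)"
          by (intro sum.cong) auto
        then show ?thesis using T t by simp
      qed
      ultimately show ?thesis unfolding sum.distrib by simp
    qed
    also have "real (card A) \<le> 3 * real (card V)"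
    proof -
      have "A \<subseteq> (\<lambda>(e, z). insert z e) ` (nsets t 2 \<times> V)"
      proof
        fix t' assume "t' \<in> A"
        then have t': "t' \<subseteq> V" "finite t'" "card t' = 3" "card (t \<inter> t') = 2"
          unfolding A_def nsets_def by auto
        then have "card (t' - t \<inter> t') = 1" by (subst card_Diff_subset) auto
        then obtain z where "t' - t \<inter> t' = {z}" by (rule card_1_singletonE)
        then have eq: "t' = (case (t \<inter> t', z) of (e, z) \<Rightarrow> insert z e)" and "z \<in> V"
          unfolding prod.case using t' by blast+
        moreover have "t \<inter> t' \<in> nsets t 2" using t' tV unfolding nsets_def by auto
        ultimately have "(t \<inter> t', z) \<in> nsets t 2 \<times> V" by blast
        then show "t' \<in> (\<lambda>(e, z). insert z e) ` (nsets t 2 \<times> V)" by (rule rev_image_eqI) (rule eq)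
      qed
      then have "card A \<le> card (nsets t 2 \<times> V)"
        using V tV by (meson card_image_le card_mono finite_SigmaI finite_imageI finite_imp_finite_nsets order_trans)
      also have "\<dots> = 3 * card V" using tV by (simp add: card_cartesian_product choose_two)
      finally show ?thesis by simp
    qed
    finally show "(\<Sum>t'\<in>?T. (1 / q) ^ card (nsets t 2 \<inter> nsets t' 2))
      \<le> real (card V choose 3) + (1 / q) ^ 3 + 3 * real (card V) * (1 / q)"
      using q by (simp add: divide_right_mono)
  qed
  then show ?thesis by simp
qed

lemma triangle_packing_number_mono:
  assumes "finite V" "H \<subseteq> H'"
  shows "triangle_packing_number V H \<le> triangle_packing_number V H'"
proof -
  obtain P where P: "triangle_packing V H P" "card P = triangle_packing_number V H"
    using obtain_maximum_triangle_packing[OF assms(1)] by blast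
  then have "triangle_packing V H' P" using assms(2) unfolding triangle_packing_def by blast
  then show ?thesis using card_le_triangle_packing_number[OF assms(1)] P by metis
qed

text \<open>
  A triple that fails to enlarge a maximum packing meets one of its \<open>3 * \<nu>\<close> vertices, and every vertex
  lies in a fraction \<open>3 / card V\<close> of all triples.
\<close>

lemma few_triples_do_not_enlarge_packing:
  assumes V: "finite V" "V \<noteq> {}"
  shows "real (card {t \<in> nsets V 3. real (triangle_packing_number V (H \<union> nsets t 2)) < real (triangle_packing_number V H) + 1})
    \<le> real (card V choose 3) * (9 / real (card V) * real (triangle_packing_number V H))"
proof -
  obtain P where P: "triangle_packing V H P" "card P = triangle_packing_number V H"
    using obtain_maximum_triangle_packing[OF V(1)] by blast
  have PV: "\<Union>P \<subseteq> V" using P unfolding triangle_packing_def nsets_def by blast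
  then have finP: "finite (\<Union>P)" using V finite_subset by blast
  let ?B = "{t \<in> nsets V 3. real (triangle_packing_number V (H \<union> nsets t 2)) < real (triangle_packing_number V H) + 1}"
  have "?B \<subseteq> (\<Union>w\<in>\<Union>P. insert w ` nsets (V - {w}) 2)"
  proof
    fix t assume t: "t \<in> ?B"
    then have tV: "t \<subseteq> V" "finite t" "card t = 3" unfolding nsets_def by auto
    have "t \<inter> \<Union>P \<noteq> {}"
    proof
      assume disj: "t \<inter> \<Union>P = {}"
      have "triangle_packing V (H \<union> nsets t 2) (insert t P)"
        using P t disj unfolding triangle_packing_def by (auto simp: pairwise_insert disjnt_def)
      moreover have "t \<notin> P"
      proof -
        have "t \<noteq> {}" using tV by auto
        then show ?thesis using disj by blast
      qed
      moreover have "finite P" using P V unfolding triangle_packing_def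
        by (meson finite_imp_finite_nsets finite_subset)
      ultimately have "Suc (card P) \<le> triangle_packing_number V (H \<union> nsets t 2)"
        using card_le_triangle_packing_number[OF V(1)] by fastforce
      then show False using t P by auto
    qed
    then obtain w where w: "w \<in> t" "w \<in> \<Union>P" by blast
    have "t - {w} \<in> nsets (V - {w}) 2" using tV w unfolding nsets_def by auto
    moreover have "t = insert w (t - {w})" using w by blast
    ultimately show "t \<in> (\<Union>w\<in>\<Union>P. insert w ` nsets (V - {w}) 2)" using w by blast
  qed
  then have "card ?B \<le> card (\<Union>w\<in>\<Union>P. insert w ` nsets (V - {w}) 2)"
    using finP V by (intro card_mono finite_UN_I finite_imageI finite_imp_finite_nsets) auto
  also have "\<dots> \<le> (\<Sum>w\<in>\<Union>P. card (insert w ` nsets (V - {w}) 2))" by (rule card_UN_le[OF finP])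
  also have "\<dots> \<le> (\<Sum>w\<in>\<Union>P. (card V - 1) choose 2)"
  proof (rule sum_mono)
    fix w assume "w \<in> \<Union>P"
    then have "card (V - {w}) = card V - 1" using PV by (intro card_Diff_singleton) blast
    moreover have "card (insert w ` nsets (V - {w}) 2) \<le> card (nsets (V - {w}) 2)"
      using V by (intro card_image_le finite_imp_finite_nsets) simp
    ultimately show "card (insert w ` nsets (V - {w}) 2) \<le> (card V - 1) choose 2" by simp
  qed
  also have "\<dots> = 3 * card P * ((card V - 1) choose 2)"
    using triangle_packing_card_Union[OF V(1) P(1)] by simp
  finally have B: "card ?B \<le> 3 * card P * ((card V - 1) choose 2)" .
  obtain m where m: "card V = Suc m" using V by (metis card_0_eq not0_implies_Suc)
  have "Suc m * (m choose 2) = 3 * (Suc m choose 3)"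
    using Suc_times_binomial[of 2 m] by (simp add: eval_nat_numeral)
  then have "real (card V) * real ((card V - 1) choose 2) = 3 * real (card V choose 3)"
    unfolding m by (metis diff_Suc_1 of_nat_mult of_nat_numeral)
  then have eq: "real ((card V - 1) choose 2) = 3 * real (card V choose 3) / real (card V)"
    using m by (simp add: field_simps)
  have "real (card ?B) \<le> real (3 * card P * ((card V - 1) choose 2))" using B by (simp only: of_nat_le_iff)
  also have "\<dots> = real (card V choose 3) * (9 / real (card V) * real (triangle_packing_number V H))"
    unfolding of_nat_mult eq P(2) by simp
  finally show ?thesis .
qed

section \<open>The chromatic number of a random graph\<close>

lemma exp_le_hundredth: "x \<le> - 7 \<Longrightarrow> exp (x::real) \<le> 1 / 100"
proof -
  assume "x \<le> - 7"
  have "(2::real) ^ 7 \<le> exp 1 ^ 7"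
    using exp_ge_add_one_self[of "1::real"] by (intro power_mono) auto
  then have "(100::real) \<le> exp 7" by (simp add: exp_of_nat_mult[symmetric])
  also have "\<dots> \<le> exp (- x)" using \<open>x \<le> - 7\<close> by simp
  finally show ?thesis by (simp add: exp_minus field_simps)
qed

text \<open>
  The scale \<open>s\<close> is about \<open>n / 1000\<close>: small enough that sets of fewer than \<open>6 * s\<close> vertices span on average
  less than half of the forbidden number \<open>d / 64 * card Z\<close> of edges, and linear in \<open>n\<close>, so that the
  expected number of edges between two sets of size \<open>s\<close>, of order \<open>d * n\<close>, beats the number \<open>4 ^ n\<close> of
  pairs of sets. The hypothesis on \<open>ln n\<close> pays for the union bounds over vertices, and the one on
  \<open>d ^ 3\<close> excludes cliques on four vertices and large bouquets.
\<close>

lemma prob_chromatic_number_far_from_packing_formula: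
  fixes n :: nat and q d :: real
  defines "V \<equiv> {..<n}"
  assumes q: "0 < q" "q \<le> 1" and d: "d = real n * q" "100000000 \<le> d"
    and lnn: "1000 * ln (real n) \<le> d" and dn: "1000 * d ^ 3 \<le> real n"
  shows "subset_prob q (nsets V 2) (\<lambda>H.
      \<not> (n \<le> 2 * chromatic_number V (nsets V 2 - H) + triangle_packing_number V H \<and>
         2 * chromatic_number V (nsets V 2 - H) + triangle_packing_number V H \<le> n + 1)) \<le> 1 / 10"
proof -
  have V: "finite V" "card V = n" unfolding V_def by auto
  have q01: "0 \<le> q" "q \<le> 1" using q by auto
  have d1: "1 \<le> d" "0 < d" using d by auto
  have "d * 1 \<le> d * d ^ 2" using d1 by (intro mult_left_mono) (auto simp: one_le_power)
  then have d3: "d \<le> d ^ 3" by (simp add: power3_eq_cube power2_eq_square)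
  have n: "100000000 \<le> real n" using d3 dn d by linarith
  then have n0: "0 < real n" by linarith
  have n_exp: "real n * exp x = exp (ln (real n) + x)" for x using n0 by (simp add: exp_add)
  define s where "s = n div 1000"
  have s: "1000 * s \<le> n" "n < 1000 * s + 1000" 
    using div_mult_mod_eq[of n 1000] mod_less_divisor[of 1000 n] unfolding s_def by linarith+
  have s_le: "1000 * real s \<le> real n" using s by linarith
  have s_ge: "real n / 2000 \<le> real s" using s n by linarith
  have s1: "1 \<le> s" using s n by linarith
  let ?K = "\<lambda>H. \<exists>Q\<in>nsets V 4. nsets Q 2 \<subseteq> H"
  let ?D = "\<lambda>H. \<exists>x\<in>V. real (card {y \<in> V. {x, y} \<in> H}) \<le> d / 8"
  let ?S = "\<lambda>H. \<exists>Z\<in>{Z. Z \<subseteq> V \<and> Z \<noteq> {} \<and> card Z < 6 * s}. d / 64 * real (card Z) \<le> real (card (nsets Z 2 \<inter> H))"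
  let ?E = "\<lambda>H. \<exists>(A, B)\<in>{(A, B). A \<subseteq> V \<and> B \<subseteq> V \<and> A \<inter> B = {} \<and> card A = s \<and> card B = s}.
         \<forall>x\<in>A. \<forall>y\<in>B. {x, y} \<notin> H"
  let ?B = "\<lambda>H. \<exists>x\<in>V. \<exists>K. bouquet V H x K \<and> d / 48 \<le> real (card K)"
  have K: "subset_prob q (nsets V 2) ?K \<le> 1 / 100"
  proof -
    have "subset_prob q (nsets V 2) ?K \<le> real n ^ 4 * q ^ 6"
      using prob_K4[OF V(1) q01] V by simp
    also have "\<dots> = (d ^ 3 / real n) ^ 2"
      using n0 unfolding d(1) by (simp add: power_mult_distrib field_simps flip: power_add power_mult)
    also have "\<dots> \<le> (1 / 1000) ^ 2"
      using dn n0 d1 by (intro power_mono) (auto simp: field_simps)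
    finally show ?thesis by (simp add: power2_eq_square)
  qed
  have D: "subset_prob q (nsets V 2) ?D \<le> 1 / 100"
  proof -
    have "subset_prob q (nsets V 2) ?D \<le> real n * exp (d / 8 - q * (real n - 1) / 2)"
      using prob_low_degree[OF V(1) q01, of "d / 8"] V by simp
    also have "\<dots> = exp (ln (real n) + (d / 8 - q * (real n - 1) / 2))" by (rule n_exp)
    also have "\<dots> \<le> 1 / 100"
    proof (rule exp_le_hundredth)
      have "q * (real n - 1) = d - q" unfolding d(1) by (simp add: algebra_simps)
      then show "ln (real n) + (d / 8 - q * (real n - 1) / 2) \<le> - 7" using lnn d(2) q by linarith
    qed
    finally show ?thesis .
  qed
  have S: "subset_prob q (nsets V 2) ?S \<le> 3 / 100"
  proof -
    have "q * real (card Z) \<le> d / 64 / 2" if "Z \<subseteq> V" "card Z < 6 * s" for Z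
    proof -
      have "real (card Z) \<le> 6 * real n / 1000" using that(2) s_le by linarith
      then have "q * real (card Z) \<le> q * (6 * real n / 1000)" using q by (intro mult_left_mono) auto
      then show ?thesis using d1 unfolding d(1) by (simp add: field_simps)
    qed
    then have "subset_prob q (nsets V 2) ?S \<le> exp (real n * exp (- (d / 64) / 2)) - 1"
      using prob_dense_spot[OF V(1) q01, of "6 * s" "d / 64"] V d1 by simp
    moreover have "real n * exp (- (d / 64) / 2) \<le> 1 / 100"
      unfolding n_exp by (rule exp_le_hundredth) (use lnn d(2) in simp)
    moreover have "exp (1 / 100 :: real) \<le> 1 + 3 / 100"
      using exp_bound[of "1 / 100 :: real"] by (simp add: power2_eq_square)
    ultimately show ?thesis by (smt (verit) exp_le_cancel_iff)
  qed
  have E: "subset_prob q (nsets V 2) ?E \<le> 1 / 100"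
  proof -
    have "subset_prob q (nsets V 2) ?E \<le> 4 ^ n * exp (- q * (real s)\<^sup>2 / 2)"
      using prob_hole[OF V(1) q01, of s] V by simp
    also have "(4::real) ^ n \<le> exp (2 * real n)"
    proof -
      have "(2::real) \<le> exp 1" using exp_ge_add_one_self[of "1::real"] by simp
      then have "2 * 2 \<le> exp 1 * exp (1::real)" by (intro mult_mono) auto
      then have "(4::real) \<le> exp 2" by (simp flip: exp_add)
      then have "(4::real) ^ n \<le> exp 2 ^ n" by (intro power_mono) auto
      then show ?thesis by (simp add: exp_of_nat_mult[symmetric] mult.commute)
    qed
    also have "exp (2 * real n) * exp (- q * (real s)\<^sup>2 / 2) = exp (2 * real n - q * (real s)\<^sup>2 / 2)"
      by (simp flip: exp_add)
    also have "\<dots> \<le> 1 / 100"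
    proof (rule exp_le_hundredth)
      have "(real n / 2000)\<^sup>2 \<le> (real s)\<^sup>2" using s_ge n0 by (intro power_mono) auto
      then have "q * (real n / 2000)\<^sup>2 \<le> q * (real s)\<^sup>2" using q by (intro mult_left_mono) auto
      moreover have "q * (real n / 2000)\<^sup>2 = d * real n / 4000000"
        unfolding d(1) by (simp add: power2_eq_square)
      moreover have "100000000 * real n \<le> d * real n" using d n0 by (intro mult_right_mono) auto
      ultimately show "2 * real n - q * (real s)\<^sup>2 / 2 \<le> - 7" using n by linarith
    qed
    finally show ?thesis by simp
  qed
  have B: "subset_prob q (nsets V 2) ?B \<le> 1 / 100"
  proof -
    have "subset_prob q (nsets V 2) ?B \<le> real n * exp (9 * real n ^ 3 * q ^ 4 - d / 48)"
      using prob_large_bouquet[OF V(1) q01, of "d / 48"] V d1 by simp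
    also have "\<dots> = exp (ln (real n) + (9 * real n ^ 3 * q ^ 4 - d / 48))" by (rule n_exp)
    also have "\<dots> \<le> 1 / 100"
    proof (rule exp_le_hundredth)
      have "real n ^ 3 * q ^ 4 = d * (d ^ 3 / real n)"
        using n0 unfolding d(1) by (simp add: eval_nat_numeral field_simps)
      also have "\<dots> \<le> d * (1 / 1000)"
        using dn n0 d1 by (intro mult_left_mono) (auto simp: field_simps)
      finally show "ln (real n) + (9 * real n ^ 3 * q ^ 4 - d / 48) \<le> - 7"
        using lnn d(2) unfolding mult.assoc[of 9] by linarith
    qed
    finally show ?thesis .
  qed
  have "subset_prob q (nsets V 2) (\<lambda>H.
      \<not> (n \<le> 2 * chromatic_number V (nsets V 2 - H) + triangle_packing_number V H \<and>
         2 * chromatic_number V (nsets V 2 - H) + triangle_packing_number V H \<le> n + 1))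
     \<le> subset_expectation q (nsets V 2) (\<lambda>H. of_bool (?K H) + (of_bool (?D H) + (of_bool (?S H) + (of_bool (?E H) + of_bool (?B H)))))"
  proof (rule subset_expectation_mono[OF q01])
    fix H assume H: "H \<subseteq> nsets V 2"
    have good: "n \<le> 2 * chromatic_number V (nsets V 2 - H) + triangle_packing_number V H \<and>
         2 * chromatic_number V (nsets V 2 - H) + triangle_packing_number V H \<le> n + 1"
      if g: "\<not> ?K H" "\<not> ?D H" "\<not> ?S H" "\<not> ?E H" "\<not> ?B H"
    proof
      show "n \<le> 2 * chromatic_number V (nsets V 2 - H) + triangle_packing_number V H"
        using card_le_chromatic_number_plus_packing[OF V(1), of H] g(1) V by auto
      obtain P where P: "triangle_packing V H P" "card P = triangle_packing_number V H"
        using obtain_maximum_triangle_packing[OF V(1)] by blast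
      have "\<exists>M. matching_in {e \<in> H. e \<subseteq> V - \<Union>P} M \<and> card (V - \<Union>P - \<Union>M) \<le> 1"
      proof (rule pseudorandom_near_perfect_matching[OF V(1) H d1(2) s1 _ _ _ _ P(1)])
        show "d / 8 < real (card {y \<in> V. {x, y} \<in> H})" if "x \<in> V" for x
          using g(2) that by force
        show "real (card (nsets Z 2 \<inter> H)) < d / 64 * real (card Z)"
          if "Z \<subseteq> V" "Z \<noteq> {}" "card Z < 6 * s" for Z
          using g(3) that by force
        show "\<exists>x\<in>A. \<exists>y\<in>B. {x, y} \<in> H"
          if "A \<subseteq> V" "B \<subseteq> V" "A \<inter> B = {}" "card A = s" "card B = s" for A B
          using g(4) that by blast
        show "real (card K) < d / 48" if "x \<in> V" "bouquet V H x K" for x K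
          using g(5) that by force
      qed
      then obtain M where "matching_in {e \<in> H. e \<subseteq> V - \<Union>P} M" "card (V - \<Union>P - \<Union>M) \<le> 1" by blast
      from chromatic_number_le_packing_matching[OF V(1) H P(1) this]
      show "2 * chromatic_number V (nsets V 2 - H) + triangle_packing_number V H \<le> n + 1"
        using P(2) V(2) by simp
    qed
    have "of_bool (\<not> G) \<le> of_bool k + (of_bool a + (of_bool b + (of_bool c + (of_bool e :: real))))"
      if "\<not> k \<Longrightarrow> \<not> a \<Longrightarrow> \<not> b \<Longrightarrow> \<not> c \<Longrightarrow> \<not> e \<Longrightarrow> G" for G k a b c e
      using that by (cases k; cases a; cases b; cases c; cases e) auto
    from this[OF good] show "of_bool
        (\<not> (n \<le> 2 * chromatic_number V (nsets V 2 - H) + triangle_packing_number V H \<and>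
           2 * chromatic_number V (nsets V 2 - H) + triangle_packing_number V H \<le> n + 1))
       \<le> of_bool (?K H) + (of_bool (?D H) + (of_bool (?S H) + (of_bool (?E H) + of_bool (?B H) :: real)))" .
  qed
  also have "\<dots> \<le> 1 / 10"
    unfolding subset_expectation_add using K D S E B by linarith
  finally show ?thesis .
qed

text \<open>
  The two error terms of \<open>planting_anticoncentration\<close> are the expected fraction of triples that meet a
  maximum packing, of order \<open>d ^ 3 / n\<close>, and the standard deviation of the normalised triangle count, of
  order \<open>1 / d powr (3/2)\<close>.
\<close>

lemma triangle_packing_number_anticoncentration:
  fixes n :: nat and q d a l :: real
  defines "V \<equiv> {..<n}"
  assumes q: "0 < q" "q \<le> 1" and d: "d = real n * q" "100000000 \<le> d"
    and dn: "1000 * d ^ 3 \<le> real n" and l: "0 \<le> l"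
  shows "subset_prob q (nsets V 2) (\<lambda>H. a \<le> real (triangle_packing_number V H) \<and>
      real (triangle_packing_number V H) \<le> a + l - 1) \<le> 1 / 100 + 3 * l / d powr (3/2)"
proof -
  have V: "finite V" "card V = n" unfolding V_def by auto
  have q01: "0 \<le> q" "q \<le> 1" using q by auto
  have d1: "1 \<le> d" "0 < d" using d by auto
  have "d * 1 \<le> d * d ^ 2" using d1 by (intro mult_left_mono) (auto simp: one_le_power)
  then have d3: "d \<le> d ^ 3" by (simp add: power3_eq_cube power2_eq_square)
  have n: "100000000 \<le> real n" using d3 dn d by linarith
  then have n0: "0 < real n" "3 \<le> n" by linarith+
  define N where "N = real (n choose 3)"
  have "(real n / 3) ^ 3 \<le> N" unfolding N_def using binomial_ge_n_over_k_pow_k[OF n0(2), where 'a = real] by simp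
  then have N: "real n ^ 3 / 27 \<le> N" by (simp add: power_divide)
  have N0: "0 < N" using n0 unfolding N_def by (simp add: zero_less_binomial_iff)
  define v where "v = ((1 / q) ^ 3 + 3 * real n * (1 / q)) / N"
  have v: "v \<le> 36 / d ^ 3"
  proof -
    have "v \<le> ((1 / q) ^ 3 + 3 * real n * (1 / q)) / (real n ^ 3 / 27)"
      unfolding v_def using N N0 n0 q by (intro divide_left_mono mult_pos_pos) auto
    also have "\<dots> = 27 * (1 / d ^ 3 * (1 + 3 * (d ^ 2 / real n)))"
      using n0 q unfolding d(1) by (simp add: eval_nat_numeral field_simps)
    also have "\<dots> \<le> 27 * (1 / d ^ 3 * (1 + 3 * (1 / 1000)))"
    proof -
      have "d ^ 2 \<le> d ^ 3" using d1 by (intro power_increasing) auto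
      then have "1000 * d ^ 2 \<le> real n" using dn by linarith
      then have "d ^ 2 / real n \<le> 1 / 1000" using n0 by (simp add: field_simps)
      then show ?thesis using d1 by (intro mult_left_mono add_left_mono) auto
    qed
    also have "\<dots> \<le> 36 / d ^ 3" using d1 by (simp add: field_simps)
    finally show ?thesis .
  qed
  have "(d powr (3/2))\<^sup>2 = d powr (3/2 + 3/2)" by (simp only: power2_eq_square powr_add)
  also have "\<dots> = d ^ 3" using d1 by simp
  finally have "(d powr (3/2))\<^sup>2 = d ^ 3" .
  then have sq: "sqrt (36 / d ^ 3) = 6 / d powr (3/2)"
    by (intro real_sqrt_unique) (simp_all add: power_divide)
  have "subset_prob q (nsets V 2) (\<lambda>H. a \<le> real (triangle_packing_number V H) \<and>
      real (triangle_packing_number V H) \<le> a + l - 1)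
    \<le> subset_expectation q (nsets V 2) (\<lambda>H. 9 / real n * real (triangle_packing_number V H)) + l / 2 * sqrt v"
  proof (rule planting_anticoncentration[where I = "nsets V 3" and F = "\<lambda>t. nsets t 2" and k = 3])
    show "finite (nsets V 2)" "finite (nsets V 3)" using V by (simp_all add: finite_imp_finite_nsets)
    have "card (nsets V 3) \<noteq> 0" using N0 V unfolding N_def by simp
    then show "nsets V 3 \<noteq> {}" by (metis card.empty)
    fix t assume t: "t \<in> nsets V 3"
    show "nsets t 2 \<subseteq> nsets V 2" using t by (intro nsets_mono) (auto simp: nsets_def)
    have "card t = 3" using t unfolding nsets_def by simp
    then show "card (nsets t 2) = 3" by (simp add: choose_two)
  next
    fix H t
    show "real (triangle_packing_number V H) \<le> real (triangle_packing_number V (H \<union> nsets t 2))"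
      using triangle_packing_number_mono[OF V(1), of H "H \<union> nsets t 2"] by simp
    have "V \<noteq> {}" using V n0 by auto
    then show "real (card {t \<in> nsets V 3. real (triangle_packing_number V (H \<union> nsets t 2)) < real (triangle_packing_number V H) + 1})
      \<le> real (card (nsets V 3)) * (9 / real n * real (triangle_packing_number V H))"
      using few_triples_do_not_enlarge_packing[OF V(1), of H] V by simp
  next
    show "(\<Sum>t\<in>nsets V 3. \<Sum>t'\<in>nsets V 3. (1 / q) ^ card (nsets t 2 \<inter> nsets t' 2))
       \<le> (1 + v) * (real (card (nsets V 3)))\<^sup>2"
    proof -
      have "(1 + v) * N\<^sup>2 = N * (N + (1 / q) ^ 3 + 3 * real n * (1 / q))"
        using N0 unfolding v_def by (simp add: field_simps power2_eq_square)
      then show ?thesis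
        using triangle_overlap_second_moment[OF V(1) q] V unfolding N_def by simp
    qed
  qed (use q l in auto)
  also have "subset_expectation q (nsets V 2) (\<lambda>H. 9 / real n * real (triangle_packing_number V H))
      \<le> 9 / real n * (real n ^ 3 * q ^ 3)"
    unfolding subset_expectation_cmult
    using expectation_triangle_packing_number[OF V(1) q01] V by (intro mult_left_mono) auto
  also have "9 / real n * (real n ^ 3 * q ^ 3) = 9 * (d ^ 3 / real n)"
    unfolding d(1) by (simp add: power_mult_distrib)
  also have "\<dots> \<le> 9 * (1 / 1000)" using dn n0 by (simp add: field_simps)
  also have "l / 2 * sqrt v \<le> l / 2 * (6 / d powr (3/2))"
    unfolding sq[symmetric] using v l by (intro mult_left_mono real_sqrt_le_mono) auto
  finally show ?thesis by simp
qed

text \<open>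
  When \<open>\<chi>\<close> lies in an interval of length \<open>D\<close> and is given by the packing number up to rounding, the
  packing number lies in a window of length \<open>2 * D + 1\<close>.
\<close>

theorem chromatic_number_anticoncentration:
  fixes n :: nat and q d :: real and I :: "real set"
  assumes q: "0 < q" "q \<le> 1" and d: "d = real n * q" "100000000 \<le> d"
    and lnn: "1000 * ln (real n) \<le> d" and dn: "1000 * d ^ 3 \<le> real n"
    and I: "bounded I" "diameter I \<le> 1 / 20 * d powr (3/2)"
  shows "measure_pmf.prob (gnp n (1 - q)) {E. real (chromatic_number {..<n} E) \<in> I} \<le> 1 / 2"
proof -
  define V where "V = {..<n}"
  define D where "D = 1 / 20 * d powr (3/2)"
  let ?\<chi> = "\<lambda>H. real (chromatic_number V (nsets V 2 - H))" and ?\<nu> = "\<lambda>H. real (triangle_packing_number V H)"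
  let ?good = "\<lambda>H. n \<le> 2 * chromatic_number V (nsets V 2 - H) + triangle_packing_number V H \<and>
         2 * chromatic_number V (nsets V 2 - H) + triangle_packing_number V H \<le> n + 1"
  define a where "a = real n - 2 * Sup I"
  define l where "l = 2 * D + 2"
  have q01: "0 \<le> q" "q \<le> 1" using q by auto
  have D0: "0 \<le> D" unfolding D_def by simp
  have Sup: "x \<le> Sup I \<and> Sup I \<le> x + D" if x: "x \<in> I" for x
  proof
    have bd: "bdd_above I" using I(1) by (rule bounded_imp_bdd_above)
    show "x \<le> Sup I" using x bd by (rule cSup_upper)
    show "Sup I \<le> x + D"
    proof (rule cSup_least)
      show "I \<noteq> {}" using x by blast
      fix y assume "y \<in> I"
      then have "dist y x \<le> diameter I" using x I(1) diameter_bounded_bound by blast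
      then show "y \<le> x + D" using I(2) unfolding D_def dist_real_def by linarith
    qed
  qed
  have "measure_pmf.prob (gnp n (1 - q)) {E. real (chromatic_number {..<n} E) \<in> I}
     = subset_prob q (nsets V 2) (\<lambda>H. ?\<chi> H \<in> I)"
    unfolding V_def by (rule gnp_complement_prob[OF q01])
  also have "\<dots> \<le> subset_expectation q (nsets V 2)
      (\<lambda>H. of_bool (\<not> ?good H) + of_bool (a \<le> ?\<nu> H \<and> ?\<nu> H \<le> a + l - 1))"
  proof (rule subset_expectation_mono[OF q01])
    fix H
    have "a \<le> ?\<nu> H \<and> ?\<nu> H \<le> a + l - 1" if "?good H" "?\<chi> H \<in> I"
      using Sup[OF that(2)] that(1) unfolding a_def l_def by linarith
    then show "of_bool (?\<chi> H \<in> I) \<le> of_bool (\<not> ?good H) + (of_bool (a \<le> ?\<nu> H \<and> ?\<nu> H \<le> a + l - 1) :: real)"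
      by (cases "?good H"; cases "?\<chi> H \<in> I") auto
  qed
  also have "\<dots> \<le> 1 / 10 + (1 / 100 + 3 * l / d powr (3/2))"
    unfolding subset_expectation_add V_def
    by (intro add_mono prob_chromatic_number_far_from_packing_formula triangle_packing_number_anticoncentration)
       (use q d lnn dn D0 in \<open>simp_all add: l_def\<close>)
  also have "\<dots> \<le> 1 / 2"
  proof -
    have "100000000 powr 1 \<le> d powr 1" using d by simp
    also have "\<dots> \<le> d powr (3/2)" using d by (intro powr_mono) auto
    finally have big: "100000000 \<le> d powr (3/2)" by simp
    have "3 * l / d powr (3/2) = 3 / 10 + 6 / d powr (3/2)"
    proof -
      have "0 < d powr (3/2)" using big by linarith
      then show ?thesis unfolding l_def D_def by (simp add: field_simps)
    qed
    also have "6 / d powr (3/2) \<le> 6 / 100000000" using big by (intro divide_left_mono) auto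
    finally show ?thesis by simp
  qed
  finally show ?thesis .
qed

theorem theorem1p3:
  shows "\<exists>\<epsilon> c :: real. \<epsilon> > 0 \<and> c > 0 \<and>
    (\<forall>p q :: nat \<Rightarrow> real.
       (\<forall>n. q n = 1 - p n) \<longrightarrow>
       smooth q \<longrightarrow>
       (\<lambda>n. ln (real n) / real n) \<in> o(q) \<longrightarrow>
       q \<in> o(\<lambda>n. real n powr (-2/3)) \<longrightarrow>
       (\<exists>\<^sub>\<infinity>n. \<forall>I :: real set.
          is_interval I \<longrightarrow> bounded I \<longrightarrow>
          diameter I \<le> c * real n powr (3/2) * q n powr (3/2) \<longrightarrow>
          measure_pmf.prob (gnp n (p n)) {E. real (chromatic_number {..<n} E) \<in> I} \<le> 1 - \<epsilon>))"
proof (rule exI[of _ "1/2"], rule exI[of _ "1/20"], intro conjI allI impI)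
  fix p q :: "nat \<Rightarrow> real"
  assume pq: "\<forall>n. q n = 1 - p n" and smooth: "smooth q"
    and lower: "(\<lambda>n. ln (real n) / real n) \<in> o(q)" and upper: "q \<in> o(\<lambda>n. real n powr (-2/3))"
  have q01: "0 \<le> q n" "q n \<le> 1" for n using smooth unfolding smooth_def by auto
  \<comment> \<open>The factor \<open>1 / 10\<close> in the upper bound becomes the \<open>1 / 1000\<close> needed for \<open>d ^ 3\<close> after cubing,
     and \<open>ln n \<ge> 100000\<close> turns \<open>1000 * ln n \<le> d\<close> into the lower bound on \<open>d\<close>.\<close>
  have "eventually (\<lambda>n. norm (ln (real n) / real n) \<le> 1 / 1000 * norm (q n)) sequentially"
    using landau_o.smallD[OF lower, of "1/1000"] by simp
  moreover have "eventually (\<lambda>n. norm (q n) \<le> 1 / 10 * norm (real n powr (-2/3))) sequentially"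
    using landau_o.smallD[OF upper, of "1/10"] by simp
  moreover have "eventually (\<lambda>n. 100000 \<le> ln (real n)) sequentially"
    using filterlim_compose[OF ln_at_top filterlim_real_sequentially]
    unfolding filterlim_at_top by blast
  ultimately have "eventually (\<lambda>n. \<forall>I :: real set. is_interval I \<longrightarrow> bounded I \<longrightarrow>
          diameter I \<le> 1/20 * real n powr (3/2) * q n powr (3/2) \<longrightarrow>
          measure_pmf.prob (gnp n (p n)) {E. real (chromatic_number {..<n} E) \<in> I} \<le> 1 - 1/2) sequentially"
    using eventually_gt_at_top[of 0]
  proof eventually_elim
    case (elim n)
    define d where "d = real n * q n"
    have lnn: "1000 * ln (real n) \<le> d"
      using elim q01[of n] unfolding d_def by (simp add: field_simps)
    have d8: "100000000 \<le> d" using lnn elim by simp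
    have q0: "0 < q n" using d8 q01[of n] elim unfolding d_def by (cases "q n = 0") auto
    have dn: "1000 * d ^ 3 \<le> real n"
    proof -
      have "q n ^ 3 \<le> (1 / 10 * real n powr (-2/3)) ^ 3"
        using elim q01[of n] by (intro power_mono) auto
      also have "\<dots> = 1 / 1000 * real n powr (-2)"
        using elim by (simp add: power_mult_distrib power_divide powr_power)
      also have "\<dots> = 1 / (1000 * real n ^ 2)"
        using elim by (simp add: powr_minus_divide)
      finally have "1000 * real n ^ 2 * q n ^ 3 \<le> 1" using elim by (simp add: field_simps)
      then have "real n * (1000 * real n ^ 2 * q n ^ 3) \<le> real n * 1" by (intro mult_left_mono) auto
      then show ?thesis unfolding d_def by (simp add: power_mult_distrib power3_eq_cube power2_eq_square mult_ac)
    qed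
    show ?case
    proof (intro allI impI)
      fix I :: "real set"
      assume I: "bounded I" "diameter I \<le> 1/20 * real n powr (3/2) * q n powr (3/2)"
      have "diameter I \<le> 1 / 20 * d powr (3/2)"
        using I(2) q01[of n] unfolding d_def by (simp add: powr_mult)
      from chromatic_number_anticoncentration[OF q0 q01(2) d_def d8 lnn dn I(1) this]
      show "measure_pmf.prob (gnp n (p n)) {E. real (chromatic_number {..<n} E) \<in> I} \<le> 1 - 1/2"
        using pq by simp
    qed
  qed
  then show "\<exists>\<^sub>\<infinity>n. \<forall>I :: real set. is_interval I \<longrightarrow> bounded I \<longrightarrow>
          diameter I \<le> 1/20 * real n powr (3/2) * q n powr (3/2) \<longrightarrow>
          measure_pmf.prob (gnp n (p n)) {E. real (chromatic_number {..<n} E) \<in> I} \<le> 1 - 1/2"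
    unfolding cofinite_eq_sequentially by (rule eventually_frequently[OF sequentially_bot])
qed auto

end
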